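(* Fix a label set $L$. The category of labelled Markov processes $(S,\Sigma,\{\tau_a : a\in L\})$ over coanalytic measurable spaces $(S,\Sigma)$, with zigzag morphisms, has semipullbacks; that is, every cospan in this category has a semipullback in this category.
   Context: A labelled Markov process (LMP) with label set $L$ is a structure $(S,\Sigma,\{\tau_a : a\in L\})$ where $(S,\Sigma)$ is a measurable space and, for each $a\in L$, $\tau_a\colon S\times\Sigma\to[0,1]$ is a Markov kernel: for each $s\in S$, $\tau_a(s,\cdot)$ is a (countably additive, non-negative) measure with $\tau_a(s,S)\le 1$, and for each $Q\in\Sigma$, $\tau_a(\cdot,Q)$ is $\Sigma$-Borel measurable. A zigzag morphism from $(S,\Sigma,\{\tau_a : a\in L\})$ to $(S',\Sigma',\{\tau'_a : a\in L\})$ is a surjective measurable map $f\colon(S,\Sigma)\to(S',\Sigma')$ such that $\tau_a(s,f^{-1}(Q))=\tau'_a(f(s),Q)$ for all $a\in L$, $s\in S$, $Q\in\Sigma'$. A metric space is coanalytic if it is homeomorphic to the complement of an analytic subset of a Polish space. A measurable space is coanalytic if it is isomorphic (as a measurable space) to a coanalytic metric space with its Borel $\sigma$-algebra. A cospan is a pair of morphisms $h_1\colon \mathbf S_1\to \mathbf S_0$, $h_2\colon \mathbf S_2\to \mathbf S_0$ with common codomain. A semipullback of it is an object $\mathbf S_3$ of the category together with morphisms $k_1\colon \mathbf S_3\to \mathbf S_1$, $k_2\colon \mathbf S_3\to \mathbf S_2$ of the category such that $h_1\circ k_1=h_2\circ k_2$ (no universal property is required). *)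

theory Defs
  imports "HOL-Probability.Probability"
begin

section \<open>Polish, analytic and coanalytic spaces\<close>

definition Polish_space :: "'a topology \<Rightarrow> bool" where
  "Polish_space X \<longleftrightarrow> completely_metrizable_space X \<and> separable_space X"

text \<open>A predicate on topologies cannot quantify over types. In the definitions below, existentially
  quantified Polish or coanalytic spaces are therefore taken to be topologies (unrelated to the
  Euclidean one) whose points are real numbers. This is no restriction, because a separable
  metrizable space has at most continuum many points:\<close>

lemma separable_metrizable_real_copy:
  fixes X :: "'a topology"
  assumes "metrizable_space X" and "separable_space X"
  shows "\<exists>Y :: real topology. X homeomorphic_space Y"
proof -
  obtain M d where md: "Metric_space M d" and X: "X = Metric_space.mtopology M d"
    using assms(1) unfolding metrizable_space_def by blast
  interpret Metric_space M d by (fact md)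
  obtain C where C: "countable C" "C \<subseteq> topspace X" "X closure_of C = topspace X"
    using assms(2) unfolding separable_space_def by blast
  define g where "g x = {(i, n). i \<in> from_nat_into C -` C \<and> d x (from_nat_into C i) < inverse (Suc n)}" for x
  have inj: "inj_on g (topspace X)"
  proof (rule inj_onI, rule ccontr)
    fix x y assume xy: "x \<in> topspace X" "y \<in> topspace X" "g x = g y" "x \<noteq> y"
    then have M: "x \<in> M" "y \<in> M" using X by auto
    then have "d x y > 0" using xy by auto
    then obtain n where n: "inverse (Suc n) < d x y / 2"
      using reals_Archimedean[of "d x y / 2"] by auto
    have "x \<in> X closure_of C" using C xy by simp
    then have "\<exists>c\<in>C. c \<in> mball x (inverse (Suc n))"
      unfolding X metric_closure_of by auto
    then obtain c where c: "c \<in> C" "c \<in> M" "d x c < inverse (Suc n)" by auto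
    obtain i where i: "from_nat_into C i = c"
      using from_nat_into_surj[OF C(1) c(1)] by blast
    have "(i, n) \<in> g x" using c i by (auto simp: g_def)
    then have "(i, n) \<in> g y" using xy by simp
    then have "d y c < inverse (Suc n)" using i by (auto simp: g_def)
    moreover have "d x y \<le> d x c + d y c" using triangle M c by (metis commute)
    ultimately show False using c n by linarith
  qed
  obtain h :: "nat set \<Rightarrow> real" where h: "bij h"
    using nat_sets_eqpoll_reals unfolding eqpoll_def by auto
  define f where "f x = h (prod_encode ` g x)" for x
  have f: "inj_on f (topspace X)"
  proof (rule inj_onI)
    fix x y assume xy: "x \<in> topspace X" "y \<in> topspace X" "f x = f y"
    have "prod_encode ` g x = prod_encode ` g y"
      using xy(3) injD[OF bij_is_inj[OF h]] by (simp add: f_def)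
    then have "g x = g y" by (simp add: inj_image_eq_iff inj_prod_encode)
    then show "x = y" using inj xy by (auto dest: inj_onD)
  qed
  define e where "e = inv_into (topspace X) f"
  have e: "e (f x) = x" if "x \<in> topspace X" for x
    using f that by (simp add: e_def)
  define Y where "Y = pullback_topology (f ` topspace X) e X"
  have Y: "topspace Y = f ` topspace X"
    unfolding Y_def topspace_pullback_topology using e by auto
  have "homeomorphic_maps X Y f e"
    unfolding homeomorphic_maps_def
  proof (intro conjI ballI)
    show "continuous_map X Y f"
      unfolding continuous_map_def
    proof (intro conjI allI impI)
      show "f \<in> topspace X \<rightarrow> topspace Y" using Y by auto
      fix V assume "openin Y V"
      then obtain U where U: "openin X U" "V = e -` U \<inter> f ` topspace X"
        unfolding Y_def openin_pullback_topology by blast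
      then have "f x \<in> V \<longleftrightarrow> x \<in> U" if "x \<in> topspace X" for x
        using that e[OF that] by simp
      then have "{x \<in> topspace X. f x \<in> V} = U"
        using openin_subset[OF U(1)] by blast
      then show "openin X {x \<in> topspace X. f x \<in> V}" using U by simp
    qed
    show "continuous_map Y X e"
      unfolding continuous_map_def
    proof (intro conjI allI impI)
      show "e \<in> topspace Y \<rightarrow> topspace X" using Y e by auto
      fix U assume "openin X U"
      moreover have "{y \<in> topspace Y. e y \<in> U} = e -` U \<inter> f ` topspace X" using Y by auto
      ultimately show "openin Y {y \<in> topspace Y. e y \<in> U}"
        unfolding Y_def openin_pullback_topology by auto
    qed
  qed (use Y e in auto)
  then show ?thesis unfolding homeomorphic_space_def by blast
qed

text \<open>The empty space is Polish, so the empty set is analytic.\<close>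

definition analytic_in :: "'a topology \<Rightarrow> 'a set \<Rightarrow> bool" where
  "analytic_in X A \<longleftrightarrow>
     (\<exists>(Z :: real topology) f. Polish_space Z \<and> continuous_map Z X f \<and> f ` topspace Z = A)"

definition coanalytic_space :: "'a topology \<Rightarrow> bool" where
  "coanalytic_space Y \<longleftrightarrow> metrizable_space Y \<and>
     (\<exists>(X :: real topology) A. Polish_space X \<and> analytic_in X A \<and>
        Y homeomorphic_space subtopology X (topspace X - A))"


section \<open>Coanalytic measurable spaces\<close>

text \<open>A measurable space is represented by a measure \<open>M\<close> of which only \<open>space M\<close> and \<open>sets M\<close>
  are used.\<close>

definition borel_of :: "'a topology \<Rightarrow> 'a measure" where
  "borel_of X = sigma (topspace X) {U. openin X U}"

definition measurable_isomorphic :: "'a measure \<Rightarrow> 'b measure \<Rightarrow> bool" where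
  "measurable_isomorphic M N \<longleftrightarrow>
     (\<exists>f \<in> measurable M N. \<exists>g \<in> measurable N M.
        (\<forall>x \<in> space M. g (f x) = x) \<and> (\<forall>y \<in> space N. f (g y) = y))"

definition coanalytic_measurable_space :: "'a measure \<Rightarrow> bool" where
  "coanalytic_measurable_space M \<longleftrightarrow>
     (\<exists>Y :: real topology. coanalytic_space Y \<and> measurable_isomorphic M (borel_of Y))"


section \<open>Labelled Markov processes\<close>

definition LMP :: "'l set \<Rightarrow> 'a measure \<Rightarrow> ('l \<Rightarrow> 'a \<Rightarrow> 'a measure) \<Rightarrow> bool" where
  "LMP L M \<tau> \<longleftrightarrow> (\<forall>a\<in>L. \<tau> a \<in> measurable M (subprob_algebra M))"

lemma LMP_iff:
  "LMP L M \<tau> \<longleftrightarrow>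
     (\<forall>a\<in>L. (\<forall>s\<in>space M. sets (\<tau> a s) = sets M \<and> emeasure (\<tau> a s) (space M) \<le> 1) \<and>
            (\<forall>Q\<in>sets M. (\<lambda>s. emeasure (\<tau> a s) Q) \<in> borel_measurable M))"
proof -
  have *: "subprob_space (\<tau> a s) \<and> sets (\<tau> a s) = sets M \<longleftrightarrow>
      sets (\<tau> a s) = sets M \<and> emeasure (\<tau> a s) (space M) \<le> 1" if "s \<in> space M" for a s
  proof (cases "sets (\<tau> a s) = sets M")
    case True
    then have "space (\<tau> a s) = space M" by (rule sets_eq_imp_space_eq)
    then show ?thesis using that True
      by (metis empty_iff subprob_space.emeasure_space_le_1 subprob_spaceI)
  qed simp
  show ?thesis
    unfolding LMP_def measurable_submarkov by (simp add: * cong: ball_cong)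
qed

definition coanalytic_LMP :: "'l set \<Rightarrow> 'a measure \<Rightarrow> ('l \<Rightarrow> 'a \<Rightarrow> 'a measure) \<Rightarrow> bool" where
  "coanalytic_LMP L M \<tau> \<longleftrightarrow> coanalytic_measurable_space M \<and> LMP L M \<tau>"

definition zigzag ::
    "'l set \<Rightarrow> 'a measure \<Rightarrow> ('l \<Rightarrow> 'a \<Rightarrow> 'a measure) \<Rightarrow>
     'b measure \<Rightarrow> ('l \<Rightarrow> 'b \<Rightarrow> 'b measure) \<Rightarrow> ('a \<Rightarrow> 'b) \<Rightarrow> bool" where
  "zigzag L M \<tau> N \<tau>' f \<longleftrightarrow>
     f \<in> measurable M N \<and> f ` space M = space N \<and>
     (\<forall>a\<in>L. \<forall>s\<in>space M. \<forall>Q\<in>sets N. emeasure (\<tau> a s) (f -` Q \<inter> space M) = emeasure (\<tau>' a (f s)) Q)"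

end

theory Submission
  imports Defs
begin

text \<open>The semipullback lives on the fibre product \<open>{(x, y). h1 x = h2 y}\<close>. Choose a countable family
  \<open>C\<close> of measurable sets separating the points of the base, and let \<open>P n\<close> be the finite partition generated by
  its first \<open>n\<close> members. For \<open>(x, y)\<close> in the fibre product put
  \<open>\<mu> n (A \<times> B) = (\<Sum>J\<in>P n. \<tau>1 x (A \<inter> h1 -` J) * \<tau>2 y (B \<inter> h2 -` J) / \<nu> J)\<close>, where \<open>\<nu>\<close> is the common image of
  \<open>\<tau>1 x\<close> and \<open>\<tau>2 y\<close> in the base. These measures have marginals \<open>\<tau>1 x\<close> and \<open>\<tau>2 y\<close>, and they converge on
  rectangles: by polarization it suffices that sums of the form \<open>\<Sum>J\<in>P n. a J\<^sup>2 / \<nu> J\<close> increase with \<open>n\<close>.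
  The limit depends measurably on \<open>(x, y)\<close>, since no choices are involved, and it vanishes on the rectangles
  \<open>h1 -` C i \<times> h2 -` (- C i)\<close>, which together with their mirror images cover the complement of the fibre product.
  It is countably additive because every finite measure on a coanalytic space is inner regular for
  compact sets: the analytic complement contains no compact set of positive measure, so by
  capacitability it is null.\<close>

section \<open>Polish spaces and analytic sets\<close>

text \<open>The limit coupling makes the two coordinates conditionally independent given the
  sigma-algebra generated by \<open>C\<close>. The direct construction would integrate a product of
  conditional distributions over the base; these are determined only up to null sets of
  \<open>\<nu>\<close>, and \<open>\<nu>\<close> varies with \<open>(x, y)\<close>, so versions
  depending measurably on the point would have to be found. Finite partitions replace them by
  explicit quotients. The price is that a limit taken on rectangles alone need not be countably
  additive. Here the exact marginals of \<open>\<mu> n\<close> matter: compact sets that carry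
  almost all of \<open>\<tau>1 x\<close> and \<open>\<tau>2 y\<close> bound the mass lost by every
  \<open>\<mu> n\<close> at once, so smallness along a decreasing sequence with empty intersection
  survives the limit. The carrier must also stay in the category. The complement of the fibre
  product inside the product of the ambient Polish spaces is a union of analytic sets and a Borel
  set, hence analytic. The projections are onto because \<open>h1\<close> and \<open>h2\<close>
  are.\<close>

lemma separable_metrizable_imp_second_countable:
  assumes "metrizable_space X" and "separable_space X"
  shows "second_countable X"
proof -
  obtain M d where "Metric_space M d" and X: "X = Metric_space.mtopology M d"
    using assms(1) unfolding metrizable_space_def by blast
  interpret Metric_space M d by fact
  obtain C where C: "countable C" "C \<subseteq> topspace X" "X closure_of C = topspace X"
    using assms(2) unfolding separable_space_def by blast
  define B where "B = (\<lambda>(c, n). mball c (inverse (Suc n))) ` (C \<times> (UNIV :: nat set))"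
  show ?thesis
    unfolding second_countable_def
  proof (intro exI conjI allI impI ballI)
    show "countable B" using C by (auto simp: B_def)
    show "openin X V" if "V \<in> B" for V
      using that by (auto simp: B_def X)
    fix U x assume "openin X U \<and> x \<in> U"
    then obtain r where r: "r > 0" "mball x r \<subseteq> U" and xM: "x \<in> M"
      unfolding X openin_mtopology by blast
    obtain n where n: "inverse (Suc n) < r / 2"
      using reals_Archimedean[of "r / 2"] r by auto
    have "x \<in> X closure_of C" using C xM X by simp
    then have "\<exists>c\<in>C. c \<in> mball x (inverse (Suc n))"
      unfolding X metric_closure_of by auto
    then obtain c where c: "c \<in> C" "c \<in> M" "d x c < inverse (Suc n)" by auto
    have "mball c (inverse (Suc n)) \<subseteq> mball x r"
    proof
      fix y assume "y \<in> mball c (inverse (Suc n))"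
      then have "y \<in> M" "d c y < inverse (Suc n)" by auto
      moreover from this have "d x y \<le> d x c + d c y" using triangle c xM by blast
      ultimately show "y \<in> mball x r" using c n xM by auto
    qed
    moreover have "x \<in> mball c (inverse (Suc n))" using c xM by (simp add: commute)
    moreover have "mball c (inverse (Suc n)) \<in> B" using c by (force simp: B_def)
    ultimately show "\<exists>V\<in>B. x \<in> V \<and> V \<subseteq> U" using r by blast
  qed
qed

text \<open>Second countability passes to arbitrary subspaces, which separability does not, so the
  closure properties of Polish spaces are proved in this form.\<close>

lemma Polish_space_iff_second_countable:
  "Polish_space X \<longleftrightarrow> completely_metrizable_space X \<and> second_countable X"
  unfolding Polish_space_def
  by (meson completely_metrizable_imp_metrizable_space second_countable_imp_separable_space
      separable_metrizable_imp_second_countable)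

lemma Polish_space_imp_metrizable_space: "Polish_space X \<Longrightarrow> metrizable_space X"
  by (simp add: Polish_space_def completely_metrizable_imp_metrizable_space)

lemma Polish_space_imp_Hausdorff_space: "Polish_space X \<Longrightarrow> Hausdorff_space X"
  by (simp add: Polish_space_imp_metrizable_space metrizable_imp_Hausdorff_space)

section \<open>Closure properties of second countable and Polish spaces\<close>

lemma second_countable_prod_topology:
  assumes "second_countable X" "second_countable Y"
  shows "second_countable (prod_topology X Y)"
proof -
  obtain A where A: "countable A" "\<And>V. V \<in> A \<Longrightarrow> openin X V"
    "\<And>U x. openin X U \<and> x \<in> U \<longrightarrow> (\<exists>V\<in>A. x \<in> V \<and> V \<subseteq> U)"
    using assms(1) unfolding second_countable_def by blast
  obtain B where B: "countable B" "\<And>V. V \<in> B \<Longrightarrow> openin Y V"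
    "\<And>U x. openin Y U \<and> x \<in> U \<longrightarrow> (\<exists>V\<in>B. x \<in> V \<and> V \<subseteq> U)"
    using assms(2) unfolding second_countable_def by blast
  show ?thesis
    unfolding second_countable_def
  proof (intro exI[of _ "(\<lambda>(a, b). a \<times> b) ` (A \<times> B)"] conjI allI impI ballI)
    show "openin (prod_topology X Y) V" if "V \<in> (\<lambda>(a, b). a \<times> b) ` (A \<times> B)" for V
      using that A B by (auto simp: openin_prod_Times_iff)
    fix U z assume "openin (prod_topology X Y) U \<and> z \<in> U"
    then obtain V W where VW: "openin X V" "openin Y W" "fst z \<in> V" "snd z \<in> W" "V \<times> W \<subseteq> U"
      unfolding openin_prod_topology_alt by (metis prod.collapse)
    obtain a b where "a \<in> A" "b \<in> B" "fst z \<in> a" "a \<subseteq> V" "snd z \<in> b" "b \<subseteq> W"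
      using A(3) B(3) VW by meson
    then show "\<exists>V\<in>(\<lambda>(a, b). a \<times> b) ` (A \<times> B). z \<in> V \<and> V \<subseteq> U"
      using VW by (intro bexI[of _ "a \<times> b"]) (auto simp: mem_Times_iff)
  qed (use A B in auto)
qed

text \<open>A basic open box restricts finitely many coordinates, hence only coordinates below some
  bound. Boxes are therefore indexed by finite lists over a countable alphabet; the box of a list
  leaves all coordinates from its length on free.\<close>

lemma second_countable_product_topology_nat:
  fixes X :: "nat \<Rightarrow> 'a topology"
  assumes "\<And>n. second_countable (X n)"
  shows "second_countable (product_topology X UNIV)"
proof -
  have "\<forall>n. \<exists>B. countable B \<and> (\<forall>V\<in>B. openin (X n) V) \<and>
      (\<forall>U x. openin (X n) U \<and> x \<in> U \<longrightarrow> (\<exists>V\<in>B. x \<in> V \<and> V \<subseteq> U))"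
    using assms unfolding second_countable_def by blast
  from choice[OF this] obtain B where B': "\<forall>n. countable (B n) \<and> (\<forall>V\<in>B n. openin (X n) V) \<and>
      (\<forall>U x. openin (X n) U \<and> x \<in> U \<longrightarrow> (\<exists>V\<in>B n. x \<in> V \<and> V \<subseteq> U))" ..
  have B: "countable (B n)" "V \<in> B n \<Longrightarrow> openin (X n) V"
    "openin (X n) U \<Longrightarrow> x \<in> U \<Longrightarrow> \<exists>V\<in>B n. x \<in> V \<and> V \<subseteq> U" for n U V x
    using B'[rule_format, of n] by simp_all
  define box where "box l = {z \<in> topspace (product_topology X UNIV). \<forall>i<length l. z i \<in> l ! i}"
    for l :: "'a set list"
  define L where "L = {l. \<forall>i<length l. l ! i \<in> B i}"
  have "L \<subseteq> lists (\<Union>n. B n)"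
    by (fastforce simp: L_def in_set_conv_nth)
  moreover have "countable (lists (\<Union>n. B n))"
    by (intro countable_lists countable_UN B(1)) simp
  ultimately have "countable L"
    by (rule countable_subset)
  have box_open: "openin (product_topology X UNIV) (box l)" if "l \<in> L" for l
  proof -
    have "box l = topspace (product_topology X UNIV) \<inter>
        (\<Inter>i<length l. {z \<in> topspace (product_topology X UNIV). z i \<in> l ! i})"
      by (auto simp: box_def)
    \<comment> \<open>The empty list is split off because an intersection over no indices is
      \<open>UNIV\<close>, which need not be open.\<close>
    moreover have "openin (product_topology X UNIV) \<dots>"
    proof (cases "length l = 0")
      case False
      have "openin (product_topology X UNIV) {z \<in> topspace (product_topology X UNIV). z i \<in> l ! i}"
        if "i < length l" for i
        using \<open>l \<in> L\<close> that B(2) openin_continuous_map_preimage[OF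
            continuous_map_product_projection[of i UNIV X]] by (simp add: L_def)
      then show ?thesis
        using False by (intro openin_Int openin_topspace openin_INT2) auto
    next
      case True
      then show ?thesis
        using openin_topspace[of "product_topology X UNIV"] by simp
    qed
    ultimately show ?thesis by simp
  qed
  show ?thesis
    unfolding second_countable_def
  proof (intro exI[of _ "box ` L"] conjI allI impI ballI)
    show "openin (product_topology X UNIV) V" if "V \<in> box ` L" for V
      using that box_open by auto
    fix U z assume Uz: "openin (product_topology X UNIV) U \<and> z \<in> U"
    then have "\<exists>W. finite {i \<in> UNIV. W i \<noteq> topspace (X i)} \<and> (\<forall>i\<in>UNIV. openin (X i) (W i)) \<and>
        z \<in> Pi\<^sub>E UNIV W \<and> Pi\<^sub>E UNIV W \<subseteq> U"
      unfolding openin_product_topology_alt by (elim conjE) (erule bspec)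
    then obtain W where W: "finite {i. W i \<noteq> topspace (X i)}" "\<And>i. openin (X i) (W i)"
      "z \<in> Pi\<^sub>E UNIV W" "Pi\<^sub>E UNIV W \<subseteq> U"
      by auto
    obtain N where "\<forall>i\<in>{i. W i \<noteq> topspace (X i)}. i < N"
      using W(1) finite_nat_set_iff_bounded by blast
    then have N: "W i \<noteq> topspace (X i) \<Longrightarrow> i < N" for i by blast
    have "\<forall>i. \<exists>V\<in>B i. z i \<in> V \<and> V \<subseteq> W i"
      using B(3)[OF W(2)] W(3) by (auto simp: PiE_iff)
    then obtain V where V: "\<And>i. V i \<in> B i" "\<And>i. z i \<in> V i" "\<And>i. V i \<subseteq> W i"
      by metis
    have "map V [0..<N] \<in> L" using V by (auto simp: L_def)
    moreover have "z \<in> box (map V [0..<N])"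
      using V Uz openin_subset by (fastforce simp: box_def)
    moreover have "box (map V [0..<N]) \<subseteq> U"
    proof
      fix y assume y: "y \<in> box (map V [0..<N])"
      have "y i \<in> W i" for i
      proof (cases "i < N")
        case True
        then show ?thesis using y V(3) by (auto simp: box_def)
      next
        case False
        then have "W i = topspace (X i)" using N by blast
        then show ?thesis using y by (auto simp: box_def PiE_iff)
      qed
      then show "y \<in> U" using W(4) by (auto simp: PiE_iff)
    qed
    ultimately show "\<exists>V\<in>box ` L. z \<in> V \<and> V \<subseteq> U" by blast
  qed (use \<open>countable L\<close> in auto)
qed

lemma Polish_space_prod_topology:
  "Polish_space X \<Longrightarrow> Polish_space Y \<Longrightarrow> Polish_space (prod_topology X Y)"
  by (simp add: Polish_space_iff_second_countable completely_metrizable_space_prod_topology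
      second_countable_prod_topology)

lemma Polish_space_product_topology_nat:
  fixes X :: "nat \<Rightarrow> 'a topology"
  shows "(\<And>n. Polish_space (X n)) \<Longrightarrow> Polish_space (product_topology X UNIV)"
  by (simp add: Polish_space_iff_second_countable completely_metrizable_space_product_topology
      second_countable_product_topology_nat)

lemma Polish_space_closedin:
  "Polish_space X \<Longrightarrow> closedin X S \<Longrightarrow> Polish_space (subtopology X S)"
  by (simp add: Polish_space_iff_second_countable completely_metrizable_space_closedin
      second_countable_subtopology)

lemma Polish_space_openin:
  "Polish_space X \<Longrightarrow> openin X S \<Longrightarrow> Polish_space (subtopology X S)"
  by (simp add: Polish_space_iff_second_countable completely_metrizable_space_openin
      second_countable_subtopology)

lemma Polish_space_discrete_topology: "countable A \<Longrightarrow> Polish_space (discrete_topology A)"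
  by (simp add: Polish_space_def completely_metrizable_space_discrete_topology
      separable_space_discrete_topology)

lemma Polish_space_homeomorphic: "X homeomorphic_space Y \<Longrightarrow> Polish_space X \<Longrightarrow> Polish_space Y"
  unfolding Polish_space_def
  using homeomorphic_completely_metrizable_space homeomorphic_separable_space by blast

section \<open>Analytic sets\<close>

lemma analytic_inI:
  assumes "Polish_space Z" and f: "continuous_map Z X f"
  shows "analytic_in X (f ` topspace Z)"
proof -
  \<comment> \<open>\<open>analytic_in\<close> asks for a source whose points are reals. A
    homeomorphic copy supplies it, so that from here on products and subspaces of any point type can
    serve as sources.\<close>
  obtain Y :: "real topology" where Y: "Z homeomorphic_space Y"
    using separable_metrizable_real_copy assms(1)
    by (meson Polish_space_def Polish_space_imp_metrizable_space)
  then obtain g h where gh: "homeomorphic_maps Z Y g h"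
    unfolding homeomorphic_space_def by blast
  then have hY: "h ` topspace Y = topspace Z"
    using homeomorphic_imp_surjective_map homeomorphic_maps_map by blast
  have "continuous_map Y X (f \<circ> h)"
    using gh f by (auto simp: homeomorphic_maps_def intro: continuous_map_compose)
  moreover have "(f \<circ> h) ` topspace Y = f ` topspace Z"
    unfolding image_comp[symmetric] hY ..
  ultimately show ?thesis
    unfolding analytic_in_def
    using Polish_space_homeomorphic[OF Y assms(1)]
    by (intro exI[of _ Y] exI[of _ "f \<circ> h"]) simp
qed

lemma analytic_in_subset: "analytic_in X A \<Longrightarrow> A \<subseteq> topspace X"
  by (auto simp: analytic_in_def continuous_map_def)

lemma analytic_in_empty: "analytic_in X {}"
proof -
  have "Polish_space (discrete_topology ({} :: nat set))"
    by (rule Polish_space_discrete_topology) simp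
  from analytic_inI[OF this, of X undefined] show ?thesis by simp
qed

lemma analytic_in_continuous_image:
  assumes "analytic_in X A" "continuous_map X Y f"
  shows "analytic_in Y (f ` A)"
proof -
  obtain Z :: "real topology" and g where
    Z: "Polish_space Z" "continuous_map Z X g" "g ` topspace Z = A"
    using assms(1) unfolding analytic_in_def by blast
  show ?thesis
    using analytic_inI[OF Z(1) continuous_map_compose[OF Z(2) assms(2)]]
    unfolding image_comp[symmetric] Z(3) .
qed

lemma analytic_in_closedin: "Polish_space X \<Longrightarrow> closedin X S \<Longrightarrow> analytic_in X S"
  using analytic_inI[OF Polish_space_closedin[of X S], of X id]
  by (simp add: continuous_map_from_subtopology closedin_subset inf.absorb2)

lemma analytic_in_openin: "Polish_space X \<Longrightarrow> openin X S \<Longrightarrow> analytic_in X S"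
  using analytic_inI[OF Polish_space_openin[of X S], of X id]
  by (simp add: continuous_map_from_subtopology openin_subset inf.absorb2)

lemma analytic_in_Times:
  assumes "analytic_in X A" "analytic_in Y B"
  shows "analytic_in (prod_topology X Y) (A \<times> B)"
proof -
  obtain Z :: "real topology" and f where
    Z: "Polish_space Z" "continuous_map Z X f" "f ` topspace Z = A"
    using assms(1) unfolding analytic_in_def by blast
  obtain W :: "real topology" and g where
    W: "Polish_space W" "continuous_map W Y g" "g ` topspace W = B"
    using assms(2) unfolding analytic_in_def by blast
  have "continuous_map (prod_topology Z W) (prod_topology X Y) (\<lambda>(x, y). (f x, g y))"
    using continuous_map_compose[OF continuous_map_fst[of Z W] Z(2)]
      continuous_map_compose[OF continuous_map_snd[of Z W] W(2)]
    by (simp add: continuous_map_pairwise comp_def case_prod_unfold)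
  from analytic_inI[OF Polish_space_prod_topology[OF Z(1) W(1)] this]
  have "analytic_in (prod_topology X Y) ((\<lambda>(x, y). (f x, g y)) ` (topspace Z \<times> topspace W))"
    by simp
  also have "(\<lambda>(x, y). (f x, g y)) ` (topspace Z \<times> topspace W) = A \<times> B"
    using Z W by auto
  finally show ?thesis .
qed

text \<open>The product of all sources with a discrete copy of the naturals plays the role of their
  disjoint sum: the number \<open>n\<close> selects the coordinate that is mapped. The projection to
  coordinate \<open>n\<close> is onto because no source is empty, and this is where
  \<open>ne\<close> enters.\<close>

lemma analytic_in_nonempty_UN:
  assumes "\<And>n::nat. analytic_in X (A n)" and ne: "\<And>n. A n \<noteq> {}"
  shows "analytic_in X (\<Union>n. A n)"
proof -
  have "\<forall>n. \<exists>(Z :: real topology) f. Polish_space Z \<and> continuous_map Z X f \<and> f ` topspace Z = A n"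
    using assms(1) unfolding analytic_in_def by blast
  then obtain Z :: "nat \<Rightarrow> real topology" and f where
    Z: "\<And>n. Polish_space (Z n)" "\<And>n. continuous_map (Z n) X (f n)" "\<And>n. f n ` topspace (Z n) = A n"
    by metis
  define P where "P = prod_topology (product_topology Z UNIV) (discrete_topology (UNIV :: nat set))"
  have P: "Polish_space P"
    unfolding P_def by (intro Polish_space_prod_topology Polish_space_product_topology_nat Z
      Polish_space_discrete_topology) auto
  have "continuous_map P X (\<lambda>(z, n). f n (z n))"
    unfolding continuous_map_def
  proof (intro conjI allI impI)
    show "(\<lambda>(z, n). f n (z n)) \<in> topspace P \<rightarrow> topspace X"
      using Z(2) by (auto simp: P_def continuous_map_def Pi_iff PiE_iff)
    fix U assume U: "openin X U"
    have "{x \<in> topspace P. (case x of (z, n) \<Rightarrow> f n (z n)) \<in> U} =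
        (\<Union>n. {z \<in> topspace (product_topology Z UNIV). f n (z n) \<in> U} \<times> {n})"
      by (auto simp: P_def)
    moreover have "openin P ({z \<in> topspace (product_topology Z UNIV). f n (z n) \<in> U} \<times> {n})" for n
      unfolding P_def openin_prod_Times_iff
      using openin_continuous_map_preimage[OF continuous_map_compose[OF
          continuous_map_product_projection[of n UNIV Z] Z(2)[of n]] U]
      by (simp add: comp_def)
    ultimately show "openin P {x \<in> topspace P. (case x of (z, n) \<Rightarrow> f n (z n)) \<in> U}"
      by auto
  qed
  from analytic_inI[OF P this]
  have "analytic_in X ((\<lambda>(z, n). f n (z n)) ` topspace P)" .
  also have "(\<lambda>(z, n). f n (z n)) ` topspace P = (\<Union>n. A n)"
  proof
    show "(\<lambda>(z, n). f n (z n)) ` topspace P \<subseteq> (\<Union>n. A n)"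
      using Z(3) by (fastforce simp: P_def PiE_iff)
    have "topspace (Z n) \<noteq> {}" for n using Z(3)[of n] ne[of n] by auto
    then have "\<forall>n. \<exists>z. z \<in> topspace (Z n)" by blast
    from choice[OF this] obtain w where w: "\<And>n. w n \<in> topspace (Z n)" by blast
    show "(\<Union>n. A n) \<subseteq> (\<lambda>(z, n). f n (z n)) ` topspace P"
    proof
      fix x assume "x \<in> (\<Union>n. A n)"
      then obtain n z where "z \<in> topspace (Z n)" "x = f n z" using Z(3) by blast
      then have "x = (\<lambda>(z, n). f n (z n)) (w(n := z), n)" "(w(n := z), n) \<in> topspace P"
        using w by (auto simp: P_def)
      then show "x \<in> (\<lambda>(z, n). f n (z n)) ` topspace P" by blast
    qed
  qed
  finally show ?thesis .
qed

lemma analytic_in_UN: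
  assumes "\<And>n::nat. analytic_in X (A n)"
  shows "analytic_in X (\<Union>n. A n)"
proof (cases "\<forall>n. A n = {}")
  case True
  then show ?thesis by (simp add: analytic_in_empty)
next
  case False
  then obtain m where "A m \<noteq> {}" by blast
  \<comment> \<open>A single empty source would empty the whole product, so empty members of the
    family are replaced by a non-empty one.\<close>
  then have "analytic_in X (\<Union>n. if A n = {} then A m else A n)"
    by (intro analytic_in_nonempty_UN) (auto simp: assms)
  also have "(\<Union>n. if A n = {} then A m else A n) = (\<Union>n. A n)"
    by (auto split: if_splits)
  finally show ?thesis .
qed

lemma analytic_in_Un:
  assumes "analytic_in X A" "analytic_in X B"
  shows "analytic_in X (A \<union> B)"
proof -
  have "analytic_in X (\<Union>n::nat. if n = 0 then A else B)"
    using assms by (intro analytic_in_UN) auto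
  also have "(\<Union>n::nat. if n = 0 then A else B) = A \<union> B"
    by (auto split: if_splits)
  finally show ?thesis .
qed

text \<open>A point of the intersection comes from a sequence of preimages, one in each source, on
  which all the maps agree. Since \<open>X\<close> is Hausdorff, these sequences form a closed
  subset \<open>E\<close> of the product of the sources, and \<open>E\<close> is again
  Polish.\<close>

lemma analytic_in_INT:
  assumes "Hausdorff_space X" and "\<And>n::nat. analytic_in X (A n)"
  shows "analytic_in X (\<Inter>n. A n)"
proof -
  have "\<forall>n. \<exists>(Z :: real topology) f. Polish_space Z \<and> continuous_map Z X f \<and> f ` topspace Z = A n"
    using assms(2) unfolding analytic_in_def by blast
  then obtain Z :: "nat \<Rightarrow> real topology" and f where
    Z: "\<And>n. Polish_space (Z n)" "\<And>n. continuous_map (Z n) X (f n)" "\<And>n. f n ` topspace (Z n) = A n"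
    by metis
  define P where "P = product_topology Z UNIV"
  have P: "Polish_space P"
    unfolding P_def by (intro Polish_space_product_topology_nat Z)
  have c: "continuous_map P X (\<lambda>z. f n (z n))" for n
    unfolding P_def
    using continuous_map_compose[OF continuous_map_product_projection[of n UNIV Z] Z(2)[of n]]
    by (simp add: comp_def)
  define E where "E = (\<Inter>n. {z \<in> topspace P. f n (z n) = f 0 (z 0)})"
  have "closedin P E"
    unfolding E_def using closedin_continuous_maps_eq[OF assms(1) c c] by blast
  then have E: "Polish_space (subtopology P E)" "topspace (subtopology P E) = E"
    using P by (auto simp: Polish_space_closedin closedin_subset inf.absorb2)
  have "analytic_in X ((\<lambda>z. f 0 (z 0)) ` E)"
    using analytic_inI[OF E(1) continuous_map_from_subtopology[OF c[of 0]]] unfolding E(2) .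
  also have "(\<lambda>z. f 0 (z 0)) ` E = (\<Inter>n. A n)"
  proof
    show "(\<lambda>z. f 0 (z 0)) ` E \<subseteq> (\<Inter>n. A n)"
    proof clarify
      fix z n assume "z \<in> E"
      then have "z n \<in> topspace (Z n)" "f n (z n) = f 0 (z 0)"
        unfolding E_def P_def topspace_product_topology PiE_iff by blast+
      then show "f 0 (z 0) \<in> A n" using Z(3)[of n] by (metis imageI)
    qed
    show "(\<Inter>n. A n) \<subseteq> (\<lambda>z. f 0 (z 0)) ` E"
    proof
      fix x assume x: "x \<in> (\<Inter>n. A n)"
      have "\<exists>z. z \<in> topspace (Z n) \<and> f n z = x" for n
        using x Z(3)[of n] by (metis INT_E UNIV_I imageE)
      then have "\<forall>n. \<exists>z. z \<in> topspace (Z n) \<and> f n z = x" ..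
      from choice[OF this] obtain z where z: "\<forall>n. z n \<in> topspace (Z n) \<and> f n (z n) = x" ..
      then have "z \<in> E" by (simp add: E_def P_def PiE_iff)
      with z show "x \<in> (\<lambda>z. f 0 (z 0)) ` E" by (intro image_eqI[of _ _ z]) simp_all
    qed
  qed
  finally show ?thesis .
qed

section \<open>Borel sets of a topology\<close>

lemma space_borel_of [simp]: "space (borel_of X) = topspace X"
  by (simp add: borel_of_def space_measure_of_conv)

lemma sets_borel_of: "sets (borel_of X) = sigma_sets (topspace X) {U. openin X U}"
  unfolding borel_of_def by (rule sets_measure_of) (auto dest: openin_subset)

lemma openin_in_borel_of: "openin X U \<Longrightarrow> U \<in> sets (borel_of X)"
  by (simp add: sets_borel_of)

lemma closedin_in_borel_of: "closedin X S \<Longrightarrow> S \<in> sets (borel_of X)"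
  by (metis closedin_def double_diff openin_in_borel_of sets.compl_sets space_borel_of subset_refl)

lemma borel_of_imp_analytic_in:
  assumes X: "Polish_space X" and "B \<in> sets (borel_of X)"
  shows "analytic_in X B"
proof -
  have "B \<in> sigma_sets (topspace X) {U. openin X U}"
    using assms(2) by (simp add: sets_borel_of)
  \<comment> \<open>The complement is carried along in the induction, since analytic sets are not
    closed under complements.\<close>
  then have "analytic_in X B \<and> analytic_in X (topspace X - B)"
  proof induction
    case (Basic U)
    then show ?case
      using X by (auto intro: analytic_in_openin analytic_in_closedin)
  next
    case Empty
    then show ?case using X by (auto intro: analytic_in_openin)
  next
    case (Compl U)
    then have "topspace X - (topspace X - U) = U"
      using analytic_in_subset by blast
    then show ?case using Compl by simp
  next
    case (Union U)
    have "topspace X - (\<Union>i. U i) = (\<Inter>i. topspace X - U i)" by blast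
    then show ?case
      using Union analytic_in_UN[of X U] X
        analytic_in_INT[of X "\<lambda>i. topspace X - U i"] Polish_space_imp_Hausdorff_space by auto
  qed
  then show ?thesis by simp
qed

section \<open>Capacitability and inner regularity\<close>

text \<open>All terms of \<open>s\<close> after index \<open>j\<close> lie in
  \<open>G (Suc j)\<close>, hence in finitely many balls of radius \<open>inverse (Suc j)\<close>,
  so the range of \<open>s\<close> is totally bounded and completeness gives a limit. The terms are
  only required to satisfy \<open>s k \<in> G k\<close>; this serves both the compactness of the
  intersection and sequences that merely approach it.\<close>

lemma (in Metric_space) totally_bounded_nest_convergent_subsequence:
  fixes G :: "nat \<Rightarrow> 'a set" and c :: "nat \<Rightarrow> 'a"
  assumes complete: mcomplete
    and G: "\<And>k. closedin mtopology (G k)" "decseq G"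
    and c: "range c \<subseteq> M"
    and cover: "\<And>k. G (Suc k) \<subseteq> (\<Union>i<N k. mcball (c i) (inverse (Suc k)))"
    and s: "\<And>k. s k \<in> G k"
  obtains l r where "l \<in> (\<Inter>k. G k)" "strict_mono r" "limitin mtopology (s \<circ> r) l sequentially"
proof -
  have sM: "s k \<in> M" for k using s[of k] closedin_subset[OF G(1)[of k]] by auto
  have "mtotally_bounded (range s)"
    unfolding mtotally_bounded_def
  proof (intro allI impI)
    fix \<epsilon> :: real assume "\<epsilon> > 0"
    then obtain j where j: "inverse (Suc j) < \<epsilon> / 2" using reals_Archimedean[of "\<epsilon> / 2"] by auto
    let ?B = "\<lambda>i. mcball (c i) (inverse (Suc j))"
    \<comment> \<open>Total boundedness of the range asks for centres in the range. A ball met by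
      the sequence is recentred at one of its terms, which doubles the radius; hence
      \<open>\<epsilon> / 2\<close> in the choice of \<open>j\<close>.\<close>
    define g where "g i = (SOME n. s n \<in> ?B i)" for i
    have g: "s (g i) \<in> ?B i" if "s n \<in> ?B i" for i n
      unfolding g_def using that by (rule someI)
    let ?K = "s ` ({..j} \<union> g ` {..<N j})"
    have "range s \<subseteq> (\<Union>x\<in>?K. mball x \<epsilon>)"
    proof clarify
      fix k
      show "s k \<in> (\<Union>x\<in>?K. mball x \<epsilon>)"
      proof (cases "k \<le> j")
        case True
        then show ?thesis using sM \<open>\<epsilon> > 0\<close> by (intro UN_I[of "s k"]) auto
      next
        case False
        then have "G k \<subseteq> G (Suc j)" using G(2) by (auto simp: decseq_def)
        with s[of k] cover[of j] obtain i where i: "i < N j" "s k \<in> ?B i"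
          by blast
        have "d (s (g i)) (s k) \<le> d (c i) (s (g i)) + d (c i) (s k)"
          using g[OF i(2)] i(2) triangle'' by auto
        then have "d (s (g i)) (s k) < \<epsilon>" using g[OF i(2)] i(2) j by auto
        then have "s k \<in> mball (s (g i)) \<epsilon>" using sM by simp
        then show ?thesis using i(1) by blast
      qed
    qed
    moreover have "finite ?K" by (intro finite_imageI finite_UnI) simp_all
    ultimately show "\<exists>K. finite K \<and> K \<subseteq> range s \<and> range s \<subseteq> (\<Union>x\<in>K. mball x \<epsilon>)"
      by (intro exI[of _ ?K] conjI) auto
  qed
  then obtain r where r: "strict_mono r" "MCauchy (s \<circ> r)"
    unfolding mtotally_bounded_sequentially by blast
  then obtain l where l: "limitin mtopology (s \<circ> r) l sequentially"
    using complete mcomplete_def by blast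
  have "l \<in> G k" for k
  proof (rule limitin_closedin[OF l G(1)])
    show "\<forall>\<^sub>F n in sequentially. (s \<circ> r) n \<in> G k"
    proof (rule eventually_sequentiallyI[of k])
      fix n assume "k \<le> n"
      then have "k \<le> r n" using seq_suble[OF r(1), of n] by simp
      then show "(s \<circ> r) n \<in> G k" using s[of "r n"] G(2) by (auto simp: decseq_def)
    qed
  qed simp
  then show ?thesis using that r(1) l by blast
qed

lemma le_SUP_add_ennreal:
  fixes a :: "nat \<Rightarrow> ennreal"
  assumes "(SUP n. a n) < \<infinity>" "\<delta> > 0"
  shows "\<exists>n. (SUP n. a n) \<le> a n + \<delta>"
proof (rule ccontr)
  assume "\<not> ?thesis"
  then have *: "a n + \<delta> < (SUP n. a n)" for n by (meson not_le)
  have "(SUP n. a n) + \<delta> = (SUP n. a n + \<delta>)"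
    by (rule ennreal_SUP_add_left[symmetric]) simp
  also have "\<dots> \<le> (SUP n. a n)"
    using * by (intro SUP_least less_imp_le) simp
  finally show False
    using assms by (metis add.right_neutral ennreal_add_left_cancel_le infinity_ennreal_def not_le top.not_eq_extremum)
qed

lemma outer_measure_of_finite: "finite_measure m \<Longrightarrow> A \<subseteq> space m \<Longrightarrow> outer_measure_of m A < \<infinity>"
  by (metis finite_measure.finite_emeasure_space infinity_ennreal_def outer_measure_of_eq
      outer_measure_of_mono sets.top top.not_eq_extremum top.extremum_uniqueI)

text \<open>This is Choquet's capacitability argument. The source is cut down repeatedly to finitely
  many balls of shrinking radius, each cut losing little outer measure of the image. What remains in
  the end is closed and totally bounded in a complete space, hence compact. The bound is stated with
  the outer measure because the image is not known to be measurable.\<close>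

lemma analytic_inner_compact:
  fixes f :: "'z \<Rightarrow> 'a"
  assumes Z: "Polish_space Z" and X: "metrizable_space X" and f: "continuous_map Z X f"
    and m: "finite_measure m" "sets m = sets (borel_of X)" and "\<epsilon> > 0"
  shows "\<exists>K. compactin X K \<and> K \<subseteq> f ` topspace Z \<and>
    outer_measure_of m (f ` topspace Z) \<le> emeasure m K + ennreal \<epsilon>"
proof (cases "topspace Z = {}")
  case True
  then show ?thesis by (intro exI[of _ "{}"]) (simp add: outer_measure_of_eq[of "{}" m])
next
  case False
  interpret m: finite_measure m by fact
  have space_m: "space m = topspace X"
    using sets_eq_imp_space_eq[OF m(2)] by simp
  obtain M d where "Metric_space M d" "Metric_space.mcomplete M d" and Zeq: "Z = Metric_space.mtopology M d"
    using Z unfolding Polish_space_def completely_metrizable_space_def by blast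
  then interpret Metric_space M d by simp
  obtain M' d' where "Metric_space M' d'" and Xeq: "X = Metric_space.mtopology M' d'"
    using X unfolding metrizable_space_def by blast
  interpret X: Metric_space M' d' by fact
  obtain C where C: "countable C" "C \<subseteq> M" "Z closure_of C = M"
    using Z unfolding Polish_space_def separable_space_def Zeq by auto
  then have "C \<noteq> {}" using False Zeq by auto
  define c where "c = from_nat_into C"
  have range_c: "range c = C"
    unfolding c_def using C \<open>C \<noteq> {}\<close> by (simp add: range_from_nat_into)
  have dense: "M = (\<Union>i. mcball (c i) r)" if "r > 0" for r
  proof
    show "M \<subseteq> (\<Union>i. mcball (c i) r)"
    proof
      fix x assume x: "x \<in> M"
      then have "\<exists>y\<in>C. y \<in> mcball x r"
        using C(3) that unfolding Zeq metric_closure_of_alt by blast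
      then obtain i where "c i \<in> mcball x r" using range_c by auto
      then have "x \<in> mcball (c i) r" by (simp add: commute)
      then show "x \<in> (\<Union>i. mcball (c i) r)" by blast
    qed
  qed auto
  have fM: "f x \<in> topspace X" if "x \<in> M" for x
    using f that by (auto simp: continuous_map_def Zeq)
  let ?o = "\<lambda>S. outer_measure_of m (f ` S)"
  \<comment> \<open>\<open>S\<close> is the increasing union of its parts inside finitely many
    balls. Their images may fail to be measurable, so the step rests on continuity of the outer
    measure along increasing sequences of arbitrary sets.\<close>
  have step: "\<exists>N. ?o S \<le> ?o (S \<inter> (\<Union>i<N. mcball (c i) r)) + \<delta>"
    if S: "S \<subseteq> M" and r: "r > 0" and "\<delta> > 0" for S r \<delta>
  proof -
    let ?T = "\<lambda>N. f ` (S \<inter> (\<Union>i<N. mcball (c i) r))"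
    have inc: "incseq ?T" by (intro monoI image_mono Int_mono UN_mono) auto
    have "S = (\<Union>N. S \<inter> (\<Union>i<N. mcball (c i) r))"
      using S dense[OF r] by blast
    then have "f ` S = (\<Union>N. ?T N)" by (metis image_UN)
    moreover have "(SUP N. outer_measure_of m (?T N)) = outer_measure_of m (\<Union>N. ?T N)"
      using S fM by (intro SUP_outer_measure_of_incseq inc) (auto simp: space_m)
    ultimately have eq: "?o S = (SUP N. outer_measure_of m (?T N))" by simp
    then have "(SUP N. outer_measure_of m (?T N)) < \<infinity>"
      using outer_measure_of_finite[OF m(1), of "f ` S"] S fM by (auto simp: space_m)
    from le_SUP_add_ennreal[OF this \<open>\<delta> > 0\<close>] show ?thesis unfolding eq .
  qed
  have "\<exists>G. \<forall>k. (closedin mtopology (G k) \<and> (k = 0 \<longrightarrow> G k = M)) \<and>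
      (\<exists>N. G (Suc k) = G k \<inter> (\<Union>i<N. mcball (c i) (inverse (Suc k))) \<and>
        ?o (G k) \<le> ?o (G (Suc k)) + ennreal (\<epsilon> * (1/2) ^ Suc k))"
  proof (rule dependent_nat_choice)
    show "\<exists>x. closedin mtopology x \<and> (0 = (0::nat) \<longrightarrow> x = M)"
      using closedin_topspace[of mtopology] by auto
    fix S and k :: nat assume S: "closedin mtopology S \<and> (k = 0 \<longrightarrow> S = M)"
    then have "S \<subseteq> M" using closedin_subset by fastforce
    with step[of S "inverse (Suc k)" "ennreal (\<epsilon> * (1/2) ^ Suc k)"] \<open>\<epsilon> > 0\<close> obtain N where
      N: "?o S \<le> ?o (S \<inter> (\<Union>i<N. mcball (c i) (inverse (Suc k)))) + ennreal (\<epsilon> * (1/2) ^ Suc k)"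
      by auto
    moreover have "closedin mtopology (S \<inter> (\<Union>i<N. mcball (c i) (inverse (Suc k))))"
      using S by (intro closedin_Int closedin_Union) auto
    ultimately show "\<exists>y. (closedin mtopology y \<and> (Suc k = 0 \<longrightarrow> y = M)) \<and>
      (\<exists>N. y = S \<inter> (\<Union>i<N. mcball (c i) (inverse (Suc k))) \<and>
        ?o S \<le> ?o y + ennreal (\<epsilon> * (1/2) ^ Suc k))"
      by (intro exI[of _ "S \<inter> (\<Union>i<N. mcball (c i) (inverse (Suc k)))"] conjI exI[of _ N]) auto
  qed
  then obtain G where G: "\<forall>k. (closedin mtopology (G k) \<and> (k = 0 \<longrightarrow> G k = M)) \<and>
      (\<exists>N. G (Suc k) = G k \<inter> (\<Union>i<N. mcball (c i) (inverse (Suc k))) \<and>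
        ?o (G k) \<le> ?o (G (Suc k)) + ennreal (\<epsilon> * (1/2) ^ Suc k))" ..
  have G_closed: "closedin mtopology (G k)" for k using G by blast
  have G0: "G 0 = M" using G by blast
  have "\<forall>k. \<exists>N. G (Suc k) = G k \<inter> (\<Union>i<N. mcball (c i) (inverse (Suc k)))" using G by blast
  from choice[OF this] obtain N where
    GSuc: "\<And>k. G (Suc k) = G k \<inter> (\<Union>i<N k. mcball (c i) (inverse (Suc k)))" by blast
  have Gm: "?o (G k) \<le> ?o (G (Suc k)) + ennreal (\<epsilon> * (1/2) ^ Suc k)" for k
    using G by blast
  have G_dec: "decseq G" using GSuc by (intro decseq_SucI) auto
  have G_M: "G k \<subseteq> M" for k using closedin_subset[OF G_closed[of k]] by simp
  have cM: "range c \<subseteq> M" using range_c C by auto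
  have cover: "G (Suc k) \<subseteq> (\<Union>i<N k. mcball (c i) (inverse (Suc k)))" for k
    using GSuc[of k] by simp
  note subseq = totally_bounded_nest_convergent_subsequence[OF \<open>mcomplete\<close> G_closed G_dec cM cover]
  define K where "K = (\<Inter>k. G k)"
  have K: "compactin mtopology K"
    unfolding compactin_sequentially
  proof (intro conjI allI impI)
    show "K \<subseteq> M" using G_M by (auto simp: K_def)
    fix s :: "nat \<Rightarrow> 'z" assume "range s \<subseteq> K"
    then have "s k \<in> G k" for k by (auto simp: K_def)
    from subseq[OF this] show "\<exists>l r. l \<in> K \<and> strict_mono r \<and> limitin mtopology (s \<circ> r) l sequentially"
      unfolding K_def by metis
  qed
  have fK: "compactin X (f ` K)"
    using image_compactin[OF K] f by (simp add: Zeq)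
  \<comment> \<open>Outer measure is not continuous from above on arbitrary sets, so the limit is
    taken along the closures of the images. This adds nothing in the end: points of the
    \<open>G k\<close> whose images tend to \<open>y\<close> have a subsequence converging to a
    point of \<open>K\<close>.\<close>
  have closures: "(\<Inter>k. X closure_of (f ` G k)) \<subseteq> f ` K"
  proof
    fix y assume y: "y \<in> (\<Inter>k. X closure_of (f ` G k))"
    have "\<exists>x. x \<in> G k \<and> f x \<in> X.mball y (inverse (Suc k))" for k
    proof -
      have "y \<in> X closure_of (f ` G k)" using y by blast
      then have "\<exists>z\<in>f ` G k. z \<in> X.mball y (inverse (Suc k))"
        unfolding Xeq X.metric_closure_of mem_Collect_eq by (auto simp del: X.in_mball)
      then show ?thesis by blast
    qed
    then have "\<forall>k. \<exists>x. x \<in> G k \<and> f x \<in> X.mball y (inverse (Suc k))" ..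
    from choice[OF this] obtain s where
      s: "\<And>k. s k \<in> G k" "\<And>k. f (s k) \<in> X.mball y (inverse (Suc k))" by blast
    obtain l r where l: "l \<in> (\<Inter>k. G k)" "strict_mono r" "limitin mtopology (s \<circ> r) l sequentially"
      using subseq[OF s(1)] by metis
    have "limitin X (f \<circ> (s \<circ> r)) (f l) sequentially"
      using continuous_map_limit[OF f] l(3) by (simp add: Zeq)
    moreover have "limitin X (f \<circ> s) y sequentially"
      unfolding Xeq X.limitin_metric
    proof (intro conjI allI impI)
      show "y \<in> M'" using s(2)[of 0] by simp
      fix e :: real assume "e > 0"
      then obtain j where j: "inverse (Suc j) < e" using reals_Archimedean by blast
      show "\<forall>\<^sub>F x in sequentially. (f \<circ> s) x \<in> M' \<and> d' ((f \<circ> s) x) y < e"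
      proof (rule eventually_sequentiallyI[of j])
        fix n assume "j \<le> n"
        then have "inverse (real (Suc n)) \<le> inverse (real (Suc j))" by simp
        moreover have "y \<in> M'" "f (s n) \<in> M'" "d' y (f (s n)) < inverse (real (Suc n))"
          using s(2)[of n] unfolding X.in_mball by blast+
        moreover from calculation j have "d' y (f (s n)) < e" by linarith
        ultimately show "(f \<circ> s) n \<in> M' \<and> d' ((f \<circ> s) n) y < e"
          unfolding comp_def X.commute[of "f (s n)" y] by blast
      qed
    qed
    then have "limitin X (f \<circ> s \<circ> r) y sequentially"
      by (rule limitin_subsequence[OF l(2)])
    ultimately have "y = f l"
      using X.limitin_metric_unique[of "f \<circ> s \<circ> r" y sequentially "f l"] by (simp add: Xeq comp_assoc)
    then show "y \<in> f ` K" using l(1) by (auto simp: K_def)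
  qed
  \<comment> \<open>\<open>\<epsilon> * (1 - (1/2) ^ k)\<close> is the sum of the losses allowed in
    the first \<open>k\<close> cuts.\<close>
  have sum: "?o M \<le> ?o (G k) + ennreal (\<epsilon> * (1 - (1/2) ^ k))" for k
  proof (induction k)
    case 0
    then show ?case by (simp add: G0)
  next
    case (Suc k)
    have "?o M \<le> ?o (G k) + ennreal (\<epsilon> * (1 - (1/2) ^ k))" by fact
    also have "\<dots> \<le> (?o (G (Suc k)) + ennreal (\<epsilon> * (1/2) ^ Suc k)) + ennreal (\<epsilon> * (1 - (1/2) ^ k))"
      by (intro add_right_mono Gm)
    also have "\<dots> = ?o (G (Suc k)) + ennreal (\<epsilon> * (1/2) ^ Suc k + \<epsilon> * (1 - (1/2) ^ k))"
      using \<open>\<epsilon> > 0\<close> by (simp add: add.assoc power_le_one)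
    also have "\<epsilon> * (1/2) ^ Suc k + \<epsilon> * (1 - (1/2) ^ k) = \<epsilon> * (1 - (1/2) ^ Suc k)"
      by (simp add: algebra_simps)
    finally show ?case .
  qed
  have closure_sets: "X closure_of (f ` G k) \<in> sets m" for k
    unfolding m(2) by (intro closedin_in_borel_of) simp
  have le: "?o M \<le> emeasure m (X closure_of (f ` G k)) + ennreal \<epsilon>" for k
  proof -
    have "f ` G k \<subseteq> X closure_of (f ` G k)"
      using G_M fM by (intro closure_of_subset) auto
    then have "?o (G k) \<le> emeasure m (X closure_of (f ` G k))"
      using outer_measure_of_mono outer_measure_of_eq[OF closure_sets] by metis
    moreover have "ennreal (\<epsilon> * (1 - (1/2) ^ k)) \<le> ennreal \<epsilon>"
      using \<open>\<epsilon> > 0\<close> by (intro ennreal_leI) (simp add: algebra_simps)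
    ultimately show ?thesis using sum[of k] by (meson add_mono order_trans)
  qed
  have "?o M \<le> (INF k. emeasure m (X closure_of (f ` G k)) + ennreal \<epsilon>)"
    by (intro INF_greatest le)
  also have "\<dots> = (INF k. emeasure m (X closure_of (f ` G k))) + ennreal \<epsilon>"
    by (intro INF_ennreal_add_const)
  also have "(INF k. emeasure m (X closure_of (f ` G k))) = emeasure m (\<Inter>k. X closure_of (f ` G k))"
    using closure_sets G_dec
    by (intro INF_emeasure_decseq) (auto simp: decseq_def intro!: closure_of_mono image_mono)
  also have "\<dots> \<le> emeasure m (f ` K)"
    unfolding m(2)
    by (intro emeasure_mono closures)
      (simp add: m closedin_in_borel_of compactin_imp_closedin[OF metrizable_imp_Hausdorff_space[OF X] fK])
  finally have "?o M \<le> emeasure m (f ` K) + ennreal \<epsilon>" by (simp add: add_right_mono)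
  moreover have "f ` K \<subseteq> f ` topspace Z" using G_M[of 0] by (auto simp: K_def Zeq)
  ultimately show ?thesis using fK by (auto simp: Zeq)
qed

text \<open>Induction over the Borel sets. An open set of a metrizable space is an increasing union
  of closed sets; taking complements exchanges the roles of \<open>C\<close> and \<open>U\<close>; a
  countable union needs the truncation below.\<close>

lemma borel_of_closed_open_approx:
  assumes X: "metrizable_space X" and m: "finite_measure m" "sets m = sets (borel_of X)"
    and "B \<in> sets m" "\<epsilon> > 0"
  shows "\<exists>C U. closedin X C \<and> openin X U \<and> C \<subseteq> B \<and> B \<subseteq> U \<and> measure m (U - C) \<le> \<epsilon>"
proof -
  interpret m: finite_measure m by fact
  have space_m: "space m = topspace X"
    using sets_eq_imp_space_eq[OF m(2)] by simp
  have cl: "C \<in> sets m" if "closedin X C" for C using that m(2) closedin_in_borel_of by blast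
  have op: "U \<in> sets m" if "openin X U" for U using that m(2) openin_in_borel_of by blast
  have "B \<in> sigma_sets (topspace X) {U. openin X U}"
    using assms by (simp add: sets_borel_of)
  then show ?thesis
    using \<open>\<epsilon> > 0\<close>
  proof (induction arbitrary: \<epsilon>)
    case (Basic U)
    then have U: "openin X U" by simp
    then have "fsigma_in X U" by (rule open_imp_fsigma_in[OF X])
    then obtain C where C: "\<And>n::nat. closedin X (C n)" "\<And>n. C n \<subseteq> C (Suc n)" "(\<Union>n. C n) = U"
      unfolding fsigma_in_ascending by auto
    have "(\<lambda>n. measure m (C n)) \<longlonglongrightarrow> measure m (\<Union>n. C n)"
      using cl C by (intro m.finite_Lim_measure_incseq incseq_SucI) auto
    then have "\<forall>\<^sub>F n in sequentially. measure m U - \<epsilon> < measure m (C n)"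
      using Basic(2) C(3) by (intro order_tendstoD) auto
    then obtain n where n: "measure m U - \<epsilon> < measure m (C n)"
      using eventually_happens'[OF sequentially_bot] by blast
    have "C n \<subseteq> U" using C(3) by blast
    then have "measure m (U - C n) = measure m U - measure m (C n)"
      using cl op C U by (intro m.finite_measure_Diff) auto
    then show ?case using C(1) U n \<open>C n \<subseteq> U\<close> by (intro exI[of _ "C n"] exI[of _ U]) auto
  next
    case Empty
    then show ?case by (intro exI[of _ "{}"]) auto
  next
    case (Compl B)
    from Compl.IH[OF Compl.prems] obtain C U where
      CU: "closedin X C" "openin X U" "C \<subseteq> B" "B \<subseteq> U" "measure m (U - C) \<le> \<epsilon>"
      by (elim exE conjE)
    have "(topspace X - C) - (topspace X - U) = U - C"
      using openin_subset[OF CU(2)] by blast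
    then show ?case
      using CU by (intro exI[of _ "topspace X - U"] exI[of _ "topspace X - C"]) auto
  next
    case (Union B)
    have "\<forall>i. \<exists>C U. closedin X C \<and> openin X U \<and> C \<subseteq> B i \<and> B i \<subseteq> U \<and>
        measure m (U - C) \<le> \<epsilon> / 2 * (1/2) ^ Suc i"
      using \<open>\<epsilon> > 0\<close> by (intro allI Union.IH) simp
    from choice[OF this] obtain C where
      "\<forall>i. \<exists>U. closedin X (C i) \<and> openin X U \<and> C i \<subseteq> B i \<and> B i \<subseteq> U \<and>
        measure m (U - C i) \<le> \<epsilon> / 2 * (1/2) ^ Suc i" ..
    from choice[OF this] obtain U where
      "\<forall>i. closedin X (C i) \<and> openin X (U i) \<and> C i \<subseteq> B i \<and> B i \<subseteq> U i \<and>
        measure m (U i - C i) \<le> \<epsilon> / 2 * (1/2) ^ Suc i" ..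
    then have CU: "closedin X (C i)" "openin X (U i)" "C i \<subseteq> B i"
      "B i \<subseteq> U i" "measure m (U i - C i) \<le> \<epsilon> / 2 * (1/2) ^ Suc i" for i
      by simp_all
    \<comment> \<open>A countable union of closed sets need not be closed, a finite one is. One half
      of \<open>\<epsilon>\<close> pays for cutting the union off at \<open>n\<close>, the other
      half for the errors of the single sets.\<close>
    define D where "D n = (\<Union>i<n. C i)" for n
    have Dcl: "closedin X (D n)" for n
      unfolding D_def using CU(1) by (intro closedin_Union) auto
    have D_UN: "(\<Union>n. D n) = (\<Union>i. C i)" by (auto simp: D_def)
    have "(\<lambda>n. measure m (D n)) \<longlonglongrightarrow> measure m (\<Union>n. D n)"
      using cl Dcl by (intro m.finite_Lim_measure_incseq) (fastforce simp: D_def incseq_def)+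
    then have "\<forall>\<^sub>F n in sequentially. measure m (\<Union>n. D n) - \<epsilon> / 2 < measure m (D n)"
      using Union(3) by (intro order_tendstoD) auto
    then obtain n where n: "measure m (\<Union>n. D n) - \<epsilon> / 2 < measure m (D n)"
      using eventually_happens'[OF sequentially_bot] by blast
    have sD: "D n \<in> sets m" "(\<Union>n. D n) \<in> sets m" using cl Dcl by auto
    have sU: "U i - C i \<in> sets m" for i using CU cl op by auto
    have half: "(\<lambda>i. \<epsilon> / 2 * (1/2) ^ Suc i) sums (\<epsilon> / 2)"
      using sums_mult[OF power_half_series, of "\<epsilon> / 2"] by simp
    have summ: "summable (\<lambda>i. measure m (U i - C i))"
      by (rule summable_comparison_test'[OF sums_summable[OF half]]) (use CU(5) in simp)
    have "measure m (\<Union>i. U i - C i) \<le> (\<Sum>i. measure m (U i - C i))"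
      using sU summ by (intro m.finite_measure_subadditive_countably) auto
    also have "\<dots> \<le> \<epsilon> / 2"
      using suminf_le[OF CU(5) summ sums_summable[OF half]] sums_unique[OF half] by simp
    finally have 1: "measure m (\<Union>i. U i - C i) \<le> \<epsilon> / 2" .
    have 2: "measure m ((\<Union>n. D n) - D n) \<le> \<epsilon> / 2"
      using n m.finite_measure_Diff[OF sD(2,1)] by (simp add: UN_upper)
    have "measure m ((\<Union>i. U i) - D n) \<le> measure m ((\<Union>i. U i - C i) \<union> ((\<Union>n. D n) - D n))"
      using sU sD by (intro m.finite_measure_mono) (auto simp: D_UN)
    also have "\<dots> \<le> measure m (\<Union>i. U i - C i) + measure m ((\<Union>n. D n) - D n)"
      using sU sD by (intro measure_Un_le) auto
    finally have "measure m ((\<Union>i. U i) - D n) \<le> \<epsilon>" using 1 2 by simp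
    moreover have "D n \<subseteq> (\<Union>i. B i)" "(\<Union>i. B i) \<subseteq> (\<Union>i. U i)"
      unfolding D_def using CU(3,4) by blast+
    ultimately show ?case
      using Dcl CU(2) by (intro exI[of _ "D n"] exI[of _ "\<Union>i. U i"]) auto
  qed
qed


section \<open>Coanalytic embeddings\<close>

lemma continuous_map_measurable_borel_of:
  assumes "continuous_map X Y f"
  shows "f \<in> measurable (borel_of X) (borel_of Y)"
  unfolding borel_of_def[of Y]
proof (rule measurable_measure_of)
  show "{U. openin Y U} \<subseteq> Pow (topspace Y)" by (auto dest: openin_subset)
  show "f \<in> space (borel_of X) \<rightarrow> topspace Y"
    using assms by (simp add: continuous_map_def)
  show "f -` U \<inter> space (borel_of X) \<in> sets (borel_of X)" if "U \<in> {U. openin Y U}" for U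
  proof -
    have "f -` U \<inter> space (borel_of X) = {x \<in> topspace X. f x \<in> U}" by auto
    then show ?thesis
      using assms that by (simp add: openin_in_borel_of openin_continuous_map_preimage)
  qed
qed

lemma sets_borel_of_subtopology:
  assumes "S \<subseteq> topspace X"
  shows "sets (borel_of (subtopology X S)) = {B \<inter> S |B. B \<in> sets (borel_of X)}"
proof -
  have "{id -` A \<inter> S |A. A \<in> sigma_sets (topspace X) {U. openin X U}} =
      sigma_sets S {id -` A \<inter> S |A. A \<in> {U. openin X U}}"
    using assms by (intro sigma_sets_vimage_commute) auto
  then show ?thesis
    using assms by (simp add: sets_borel_of openin_subtopology inf.absorb2 Setcompr_eq_image image_def conj_commute)
qed

text \<open>The coanalytic space is described by its embedding into a Polish space of arbitrary point type,
  which avoids transporting everything to topologies on the reals.\<close>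

definition coanalytic_embedding :: "'a measure \<Rightarrow> 'b topology \<Rightarrow> ('a \<Rightarrow> 'b) \<Rightarrow> bool" where
  "coanalytic_embedding M X e \<longleftrightarrow> Polish_space X \<and> inj_on e (space M) \<and> e ` space M \<subseteq> topspace X \<and>
     analytic_in X (topspace X - e ` space M) \<and>
     sets M = (\<lambda>B. e -` B \<inter> space M) ` sets (borel_of X)"

lemma coanalytic_embeddingD:
  assumes "coanalytic_embedding M X e"
  shows "Polish_space X" "inj_on e (space M)" "e ` space M \<subseteq> topspace X"
    "analytic_in X (topspace X - e ` space M)"
    "sets M = (\<lambda>B. e -` B \<inter> space M) ` sets (borel_of X)"
  using assms unfolding coanalytic_embedding_def by blast+

lemma coanalytic_measurable_space_imp_embedding:
  assumes "coanalytic_measurable_space M"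
  shows "\<exists>(X :: real topology) e. coanalytic_embedding M X e"
proof -
  obtain Y :: "real topology" where Y: "coanalytic_space Y" and MY: "measurable_isomorphic M (borel_of Y)"
    using assms unfolding coanalytic_measurable_space_def by blast
  obtain X :: "real topology" and A where X: "Polish_space X" "analytic_in X A"
    and h: "Y homeomorphic_space subtopology X (topspace X - A)"
    using Y unfolding coanalytic_space_def by blast
  let ?S = "topspace X - A"
  let ?N = "borel_of (subtopology X ?S)"
  obtain u v where "homeomorphic_maps Y (subtopology X ?S) u v"
    using h unfolding homeomorphic_space_def by blast
  then have uv: "continuous_map Y (subtopology X ?S) u" "continuous_map (subtopology X ?S) Y v"
    "\<And>y. y \<in> topspace Y \<Longrightarrow> v (u y) = y" "\<And>x. x \<in> ?S \<Longrightarrow> u (v x) = x"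
    unfolding homeomorphic_maps_def by auto
  obtain f g where fg: "f \<in> measurable M (borel_of Y)" "g \<in> measurable (borel_of Y) M"
    "\<And>x. x \<in> space M \<Longrightarrow> g (f x) = x" "\<And>y. y \<in> topspace Y \<Longrightarrow> f (g y) = y"
    using MY unfolding measurable_isomorphic_def space_borel_of by (elim bexE conjE) simp
  define e where "e = u \<circ> f"
  define e' where "e' = g \<circ> v"
  have e: "e \<in> measurable M ?N" and e': "e' \<in> measurable ?N M"
    unfolding e_def e'_def
    using fg uv by (auto intro: measurable_comp continuous_map_measurable_borel_of)
  have N: "space ?N = ?S" by auto
  have e'e: "e' (e x) = x" if "x \<in> space M" for x
    using that fg uv measurable_space[OF fg(1), of x] by (simp add: e_def e'_def)
  have ee': "e (e' x) = x" if "x \<in> ?S" for x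
    using that fg uv measurable_space[OF continuous_map_measurable_borel_of[OF uv(2)], of x]
    by (simp add: e_def e'_def N)
  have im: "e ` space M = ?S"
  proof
    show "e ` space M \<subseteq> ?S" using measurable_space[OF e] N by auto
    show "?S \<subseteq> e ` space M" using measurable_space[OF e'] ee' N by (metis image_eqI subsetI)
  qed
  have "sets M = (\<lambda>B. e -` B \<inter> space M) ` sets (borel_of X)"
  proof (intro set_eqI iffI)
    fix Q assume Q: "Q \<in> sets M"
    then have "e' -` Q \<inter> ?S \<in> sets ?N" using measurable_sets[OF e' Q] N by simp
    then obtain B where B: "B \<in> sets (borel_of X)" "e' -` Q \<inter> ?S = B \<inter> ?S"
      by (auto simp: sets_borel_of_subtopology)
    have "x \<in> Q \<longleftrightarrow> e x \<in> B" if x: "x \<in> space M" for x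
    proof -
      have "e x \<in> ?S" using x im by blast
      then have "e x \<in> B \<longleftrightarrow> e x \<in> e' -` Q \<inter> ?S" using B(2) by blast
      then show ?thesis using e'e[OF x] \<open>e x \<in> ?S\<close> by simp
    qed
    then have "Q = e -` B \<inter> space M" using sets.sets_into_space[OF Q] by blast
    then show "Q \<in> (\<lambda>B. e -` B \<inter> space M) ` sets (borel_of X)" using B(1) by blast
  next
    fix Q assume "Q \<in> (\<lambda>B. e -` B \<inter> space M) ` sets (borel_of X)"
    then obtain B where B: "B \<in> sets (borel_of X)" "Q = e -` B \<inter> space M" by blast
    then have "B \<inter> ?S \<in> sets ?N" by (auto simp: sets_borel_of_subtopology)
    then have "e -` (B \<inter> ?S) \<inter> space M \<in> sets M" by (rule measurable_sets[OF e])
    moreover have "e -` (B \<inter> ?S) \<inter> space M = Q" using B(2) im by blast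
    ultimately show "Q \<in> sets M" by simp
  qed
  moreover have "analytic_in X (topspace X - e ` space M)"
    unfolding im using X(2) analytic_in_subset[OF X(2)] by (simp add: double_diff)
  moreover have "inj_on e (space M)" using e'e by (metis inj_onI)
  moreover have "e ` space M \<subseteq> topspace X" unfolding im by blast
  ultimately have "coanalytic_embedding M X e"
    unfolding coanalytic_embedding_def using X(1) by (intro conjI)
  then show ?thesis by blast
qed

lemma coanalytic_embedding_homeomorphic:
  assumes e: "coanalytic_embedding M X e" and pq: "homeomorphic_maps X Y p q"
  shows "coanalytic_embedding M Y (p \<circ> e)"
proof -
  note e' = e[unfolded coanalytic_embedding_def]
  note setsM = coanalytic_embeddingD(5)[OF e]
  have p: "continuous_map X Y p" and q: "continuous_map Y X q"
    and qp: "\<And>x. x \<in> topspace X \<Longrightarrow> q (p x) = x" and pq': "\<And>y. y \<in> topspace Y \<Longrightarrow> p (q y) = y"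
    using pq unfolding homeomorphic_maps_def by auto
  have pX: "p ` topspace X = topspace Y"
    using homeomorphic_imp_surjective_map homeomorphic_maps_map pq by blast
  have inj: "inj_on p (topspace X)" using qp by (metis inj_onI)
  have eX: "e x \<in> topspace X" if "x \<in> space M" for x using e' that by blast
  have "X homeomorphic_space Y" using pq unfolding homeomorphic_space_def by blast
  then have "Polish_space Y" by (rule Polish_space_homeomorphic) (use e' in simp)
  moreover have "inj_on (p \<circ> e) (space M)"
    using e' inj by (metis comp_inj_on inj_on_subset)
  moreover have "(p \<circ> e) ` space M \<subseteq> topspace Y" using eX pX by auto
  moreover have "analytic_in Y (topspace Y - (p \<circ> e) ` space M)"
  proof -
    have "p ` (topspace X - e ` space M) = topspace Y - (p \<circ> e) ` space M"
      using inj_on_image_set_diff[OF inj, of "topspace X" "e ` space M"] e' pX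
      by (simp add: image_comp)
    then show ?thesis using analytic_in_continuous_image[OF _ p] e' by metis
  qed
  moreover have "sets M = (\<lambda>B. (p \<circ> e) -` B \<inter> space M) ` sets (borel_of Y)"
  proof (intro set_eqI iffI)
    fix Q assume "Q \<in> sets M"
    then obtain B where B: "B \<in> sets (borel_of X)" "Q = e -` B \<inter> space M"
      unfolding setsM by blast
    have "q -` B \<inter> topspace Y \<in> sets (borel_of Y)"
      using measurable_sets[OF continuous_map_measurable_borel_of[OF q] B(1)] by simp
    moreover have "Q = (p \<circ> e) -` (q -` B \<inter> topspace Y) \<inter> space M"
      using B(2) eX qp pX by auto
    ultimately show "Q \<in> (\<lambda>B. (p \<circ> e) -` B \<inter> space M) ` sets (borel_of Y)" by blast
  next
    fix Q assume "Q \<in> (\<lambda>B. (p \<circ> e) -` B \<inter> space M) ` sets (borel_of Y)"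
    then obtain B where B: "B \<in> sets (borel_of Y)" "Q = (p \<circ> e) -` B \<inter> space M" by blast
    have "p -` B \<inter> topspace X \<in> sets (borel_of X)"
      using measurable_sets[OF continuous_map_measurable_borel_of[OF p] B(1)] by simp
    moreover have "Q = e -` (p -` B \<inter> topspace X) \<inter> space M"
      using B(2) eX by auto
    ultimately show "Q \<in> sets M" unfolding setsM by blast
  qed
  ultimately show ?thesis unfolding coanalytic_embedding_def by blast
qed

text \<open>The image of \<open>space M\<close> with the subspace topology is the required
  coanalytic space; the embedding is a measurable isomorphism onto it, as the sets of
  \<open>M\<close> are exactly the preimages of Borel sets. The ambient space is first moved to a
  copy whose points are reals.\<close>

lemma coanalytic_embedding_imp_measurable_space:
  assumes "coanalytic_embedding M X e"
  shows "coanalytic_measurable_space M"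
proof -
  have "Polish_space X" using assms by (simp add: coanalytic_embedding_def)
  then obtain X' :: "real topology" where "X homeomorphic_space X'"
    using separable_metrizable_real_copy by (meson Polish_space_def Polish_space_imp_metrizable_space)
  then obtain p q where "homeomorphic_maps X X' p q" unfolding homeomorphic_space_def by blast
  then obtain i where i: "coanalytic_embedding M X' i"
    using coanalytic_embedding_homeomorphic[OF assms] by blast
  note i' = i[unfolded coanalytic_embedding_def]
  note setsM = coanalytic_embeddingD(5)[OF i]
  let ?S = "i ` space M"
  define Y where "Y = subtopology X' ?S"
  have Y: "topspace Y = ?S" using i' by (simp add: Y_def inf.absorb2)
  have setsY: "sets (borel_of Y) = {B \<inter> ?S |B. B \<in> sets (borel_of X')}"
    unfolding Y_def using i' by (intro sets_borel_of_subtopology) blast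
  have "topspace X' - (topspace X' - ?S) = ?S" using i' by blast
  then have "coanalytic_space Y"
    unfolding coanalytic_space_def Y_def using i' Polish_space_imp_metrizable_space
    by (metis homeomorphic_space_refl metrizable_space_subtopology)
  moreover have "measurable_isomorphic M (borel_of Y)"
    unfolding measurable_isomorphic_def
  proof (intro bexI conjI ballI)
    let ?g = "inv_into (space M) i"
    show gi: "?g (i x) = x" if "x \<in> space M" for x using i' that by simp
    show "i (?g y) = y" if "y \<in> space (borel_of Y)" for y
      using that Y by (simp add: f_inv_into_f)
    show "?g \<in> measurable (borel_of Y) M"
    proof (rule measurableI)
      show "?g y \<in> space M" if "y \<in> space (borel_of Y)" for y
        using that Y by (simp add: inv_into_into)
      fix Q assume "Q \<in> sets M"
      then obtain B where B: "B \<in> sets (borel_of X')" "Q = i -` B \<inter> space M"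
        unfolding setsM by blast
      have "?g -` Q \<inter> space (borel_of Y) = B \<inter> ?S"
        unfolding B(2) space_borel_of Y using gi by auto
      then show "?g -` Q \<inter> space (borel_of Y) \<in> sets (borel_of Y)" using setsY B(1) by blast
    qed
    show "i \<in> measurable M (borel_of Y)"
    proof (rule measurableI)
      show "i x \<in> space (borel_of Y)" if "x \<in> space M" for x using that Y by simp
      fix Q assume "Q \<in> sets (borel_of Y)"
      then obtain B where B: "B \<in> sets (borel_of X')" "Q = B \<inter> ?S" using setsY by blast
      have "i -` Q \<inter> space M = i -` B \<inter> space M" using B(2) by blast
      then show "i -` Q \<inter> space M \<in> sets M" unfolding setsM using B(1) by blast
    qed
  qed
  ultimately show ?thesis unfolding coanalytic_measurable_space_def by blast
qed


text \<open>A measurable space carries no topology of its own, so compactness is expressed through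
  the embedding \<open>e\<close> into \<open>X\<close>.\<close>

definition compactly_regular :: "'b topology \<Rightarrow> ('a \<Rightarrow> 'b) \<Rightarrow> 'a measure \<Rightarrow> bool" where
  "compactly_regular X e m \<longleftrightarrow> (\<forall>A\<in>sets m. \<forall>\<epsilon>>0. \<exists>F\<in>sets m. F \<subseteq> A \<and> measure m (A - F) \<le> \<epsilon> \<and> compactin X (e ` F))"

lemma coanalytic_embedding_measurable:
  assumes "coanalytic_embedding M X e"
  shows "e \<in> measurable M (borel_of X)"
proof (rule measurableI)
  show "e x \<in> space (borel_of X)" if "x \<in> space M" for x
    using coanalytic_embeddingD(3)[OF assms] that by auto
  show "e -` B \<inter> space M \<in> sets M" if "B \<in> sets (borel_of X)" for B
    unfolding coanalytic_embeddingD(5)[OF assms] using that by blast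
qed

lemma coanalytic_embedding_compactly_regular:
  assumes e: "coanalytic_embedding M X e" and m: "finite_measure m" "sets m = sets M"
  shows "compactly_regular X e m"
  unfolding compactly_regular_def
proof (intro ballI allI impI)
  interpret m: finite_measure m by fact
  have space_m: "space m = space M" using sets_eq_imp_space_eq[OF m(2)] .
  note X = coanalytic_embeddingD(1)[OF e] and A = coanalytic_embeddingD(4)[OF e]
    and setsM = coanalytic_embeddingD(5)[OF e]
  have Xm: "metrizable_space X" using X by (rule Polish_space_imp_metrizable_space)
  have e_meas: "e \<in> measurable m (borel_of X)"
    using coanalytic_embedding_measurable[OF e] m(2) by (simp cong: measurable_cong_sets)
  define D where "D = distr m (borel_of X) e"
  have D: "sets D = sets (borel_of X)" "space D = topspace X" by (simp_all add: D_def)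
  interpret D: finite_measure D unfolding D_def by (rule m.finite_measure_distr[OF e_meas])
  have D_eq: "emeasure D B = emeasure m (e -` B \<inter> space M)" if "B \<in> sets (borel_of X)" for B
    unfolding D_def using that e_meas space_m by (simp add: emeasure_distr)
  have D_eq': "measure D B = measure m (e -` B \<inter> space M)" if "B \<in> sets (borel_of X)" for B
    using D_eq[OF that] by (simp add: measure_def)
  have cl: "C \<in> sets D" if "closedin X C" for C using that D(1) closedin_in_borel_of by metis
  have compact_closed: "closedin X K" if "compactin X K" for K
    using that compactin_imp_closedin metrizable_imp_Hausdorff_space[OF Xm] by blast
  let ?A = "topspace X - e ` space M"
  obtain Z :: "real topology" and f where Z: "Polish_space Z" "continuous_map Z X f" "f ` topspace Z = ?A"
    using A unfolding analytic_in_def by blast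
  \<comment> \<open>A compact subset of \<open>?A\<close> has empty preimage under \<open>e\<close>,
    so the push-forward \<open>D\<close> gives it mass 0.\<close>
  have "outer_measure_of D ?A \<le> ennreal \<delta>" if \<delta>: "\<delta> > 0" for \<delta>
  proof -
    obtain K where K: "compactin X K" "K \<subseteq> ?A" "outer_measure_of D ?A \<le> emeasure D K + ennreal \<delta>"
      using analytic_inner_compact[OF Z(1) Xm Z(2) D.finite_measure_axioms D(1) \<delta>] unfolding Z(3) by blast
    have "e -` K \<inter> space M = {}" using K(2) by blast
    then have "emeasure D K = 0" using D_eq[of K] cl[OF compact_closed[OF K(1)]] D(1) by simp
    then show ?thesis using K(3) by simp
  qed
  then have "outer_measure_of D ?A = 0"
    by (metis ennreal_le_epsilon add.left_neutral le_zero_eq)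
  moreover obtain E where E: "E \<in> sets D" "?A \<subseteq> E" "outer_measure_of D ?A = emeasure D E"
    using outer_measure_of_attain[of ?A D] D(2) by blast
  ultimately have E0: "measure D E = 0" by (simp add: measure_def)
  fix Q and \<epsilon> :: real assume "Q \<in> sets m" "\<epsilon> > 0"
  then obtain B where B: "B \<in> sets (borel_of X)" "Q = e -` B \<inter> space M" unfolding m(2) setsM by blast
  \<comment> \<open>For the identity map, \<open>analytic_inner_compact\<close> says that a finite
    Borel measure on a Polish space is tight.\<close>
  have "continuous_map X X (\<lambda>x. x)" by simp
  from analytic_inner_compact[OF X Xm this D.finite_measure_axioms D(1), of "\<epsilon> / 2"] \<open>\<epsilon> > 0\<close>
  obtain K where K: "compactin X K" "outer_measure_of D (topspace X) \<le> emeasure D K + ennreal (\<epsilon> / 2)"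
    by auto
  have Kset: "K \<in> sets D" "K \<subseteq> topspace X"
    using cl[OF compact_closed[OF K(1)]] compactin_subset_topspace[OF K(1)] by auto
  have "outer_measure_of D (topspace X) = emeasure D (topspace X)"
    by (rule outer_measure_of_eq) (metis D(2) sets.top)
  then have "measure D (topspace X) \<le> measure D K + \<epsilon> / 2"
    using K(2) \<open>\<epsilon> > 0\<close> by (simp add: D.emeasure_eq_measure flip: ennreal_plus)
  then have K2: "measure D (topspace X - K) \<le> \<epsilon> / 2"
    using D.finite_measure_compl[OF Kset(1)] D(2) by simp
  \<comment> \<open>Removing the null set \<open>E\<close>, which contains \<open>?A\<close>, forces
    the inner closed set \<open>C\<close> into the image of \<open>space M\<close>. The preimage
    \<open>?F\<close> is then mapped onto all of \<open>C \<inter> K\<close>, a compact set.\<close>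
  have BE: "B - E \<in> sets D" using B(1) E(1) D(1) by auto
  from borel_of_closed_open_approx[OF Xm D.finite_measure_axioms D(1) BE, of "\<epsilon> / 2"] \<open>\<epsilon> > 0\<close>
  obtain C U where CU: "closedin X C" "openin X U" "C \<subseteq> B - E" "B - E \<subseteq> U" "measure D (U - C) \<le> \<epsilon> / 2"
    by auto
  have U: "U \<in> sets D" using CU(2) D(1) openin_in_borel_of by metis
  let ?F = "e -` (C \<inter> K) \<inter> space M"
  have CK: "C \<inter> K \<in> sets D" using cl[OF CU(1)] Kset by auto
  have "C \<inter> K \<subseteq> e ` space M"
    using CU(3) E(2) Kset(2) by blast
  then have eF: "e ` ?F = C \<inter> K" by blast
  have "compactin X (C \<inter> K)" by (rule closed_Int_compactin[OF CU(1) K(1)])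
  moreover have "?F \<in> sets m" unfolding m(2) setsM using CK D(1) by blast
  moreover have "?F \<subseteq> Q" using B(2) CU(3) by blast
  moreover have "measure m (Q - ?F) \<le> \<epsilon>"
  proof -
    have Bs: "B - C \<inter> K \<in> sets D" using B(1) CK D(1) by auto
    have "Q - ?F = e -` (B - C \<inter> K) \<inter> space M" using B(2) by blast
    then have "measure m (Q - ?F) = measure D (B - C \<inter> K)" using D_eq'[of "B - C \<inter> K"] Bs D(1) by simp
    also have "\<dots> \<le> measure D (((U - C) \<union> E) \<union> (topspace X - K))"
    proof (rule D.finite_measure_mono)
      show "B - C \<inter> K \<subseteq> ((U - C) \<union> E) \<union> (topspace X - K)"
        using CU(4) sets.sets_into_space[OF Bs] D(2) by blast
      show "((U - C) \<union> E) \<union> (topspace X - K) \<in> sets D"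
        using U cl[OF CU(1)] E(1) Kset(1) D(2) by (metis sets.Diff sets.Un sets.top)
    qed
    also have "\<dots> \<le> measure D ((U - C) \<union> E) + measure D (topspace X - K)"
      using U cl[OF CU(1)] E(1) Kset(1) D(2) by (metis sets.Diff sets.Un sets.top measure_Un_le)
    also have "measure D ((U - C) \<union> E) \<le> measure D (U - C) + measure D E"
      using U cl[OF CU(1)] E(1) by (metis sets.Diff measure_Un_le)
    finally show ?thesis using CU(5) K2 E0 by simp
  qed
  ultimately show "\<exists>F\<in>sets m. F \<subseteq> Q \<and> measure m (Q - F) \<le> \<epsilon> \<and> compactin X (e ` F)"
    using eF by (intro bexI[of _ ?F]) auto
qed

lemma coanalytic_embedding_countable_separating:
  assumes e: "coanalytic_embedding M X e"
  obtains C :: "nat \<Rightarrow> 'a set" where "\<And>i. C i \<in> sets M"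
    "\<forall>x\<in>space M. \<forall>y\<in>space M. (\<forall>i. x \<in> C i \<longleftrightarrow> y \<in> C i) \<longrightarrow> x = y"
proof -
  note X = coanalytic_embeddingD(1)[OF e] and inj = coanalytic_embeddingD(2)[OF e]
    and im = coanalytic_embeddingD(3)[OF e]
  have "second_countable X" using X by (simp add: Polish_space_iff_second_countable)
  then obtain \<B> where \<B>: "countable \<B>" "\<And>V. V \<in> \<B> \<Longrightarrow> openin X V"
    "\<forall>U x. openin X U \<and> x \<in> U \<longrightarrow> (\<exists>V\<in>\<B>. x \<in> V \<and> V \<subseteq> U)"
    unfolding second_countable_def by blast
  \<comment> \<open>The empty set is added because enumerating a countable set by
    \<open>from_nat_into\<close> has the right range only when the set is non-empty, and the base of
    an empty space may be empty.\<close>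
  define V where "V = from_nat_into (insert {} \<B>)"
  have rV: "range V = insert {} \<B>" unfolding V_def using \<B>(1) by (intro range_from_nat_into) auto
  have Vo: "openin X (V i)" for i using rV \<B>(2) by (metis insert_iff openin_empty rangeI)
  show thesis
  proof (rule that[of "\<lambda>i. e -` V i \<inter> space M"])
    show "e -` V i \<inter> space M \<in> sets M" for i
      using measurable_sets[OF coanalytic_embedding_measurable[OF e] openin_in_borel_of[OF Vo]] .
    show "\<forall>x\<in>space M. \<forall>y\<in>space M. (\<forall>i. x \<in> e -` V i \<inter> space M \<longleftrightarrow> y \<in> e -` V i \<inter> space M) \<longrightarrow> x = y"
    proof (intro ballI impI, rule ccontr)
      fix x y assume xy: "x \<in> space M" "y \<in> space M"
        and eq: "\<forall>i. x \<in> e -` V i \<inter> space M \<longleftrightarrow> y \<in> e -` V i \<inter> space M"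
      assume "x \<noteq> y"
      then have "e x \<noteq> e y" using inj xy by (meson inj_onD)
      moreover have "e x \<in> topspace X" "e y \<in> topspace X" using im xy by auto
      ultimately obtain U where U: "openin X U" "e x \<in> U" "e y \<notin> U"
        using Polish_space_imp_Hausdorff_space[OF X] unfolding Hausdorff_space_def disjnt_iff by metis
      then obtain W where "W \<in> \<B>" "e x \<in> W" "W \<subseteq> U" using \<B>(3) by blast
      then obtain i where "e x \<in> V i" "e y \<notin> V i" using rV U(3) by (metis insertI2 rangeE subsetD)
      then show False using eq[rule_format, of i] xy by auto
    qed
  qed
qed

section \<open>Borel sets of a product of topologies\<close>

lemma sets_borel_of_Times:
  assumes "A \<in> sets (borel_of X)" "B \<in> sets (borel_of Y)"
  shows "A \<times> B \<in> sets (borel_of (prod_topology X Y))"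
proof -
  have "A \<times> topspace Y = fst -` A \<inter> space (borel_of (prod_topology X Y))"
    using sets.sets_into_space[OF assms(1)] by auto
  moreover have "topspace X \<times> B = snd -` B \<inter> space (borel_of (prod_topology X Y))"
    using sets.sets_into_space[OF assms(2)] by auto
  moreover have "A \<times> B = (A \<times> topspace Y) \<inter> (topspace X \<times> B)"
    using sets.sets_into_space[OF assms(1)] sets.sets_into_space[OF assms(2)] by auto
  ultimately show ?thesis
    using measurable_sets[OF continuous_map_measurable_borel_of[OF continuous_map_fst[of X Y]] assms(1)]
      measurable_sets[OF continuous_map_measurable_borel_of[OF continuous_map_snd[of X Y]] assms(2)]
    by (metis sets.Int)
qed

text \<open>With countable bases an open set of the product is a countable union of open rectangles.
  In general the Borel sigma-algebra of a product can be strictly larger than the product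
  sigma-algebra.\<close>

lemma sets_borel_of_prod_topology:
  assumes "second_countable X" "second_countable Y"
  shows "sets (borel_of (prod_topology X Y)) = sets (borel_of X \<Otimes>\<^sub>M borel_of Y)"
proof
  obtain A where A: "countable A" "\<And>V. V \<in> A \<Longrightarrow> openin X V"
    "\<forall>U x. openin X U \<and> x \<in> U \<longrightarrow> (\<exists>V\<in>A. x \<in> V \<and> V \<subseteq> U)"
    using assms(1) unfolding second_countable_def by blast
  obtain B where B: "countable B" "\<And>V. V \<in> B \<Longrightarrow> openin Y V"
    "\<forall>U x. openin Y U \<and> x \<in> U \<longrightarrow> (\<exists>V\<in>B. x \<in> V \<and> V \<subseteq> U)"
    using assms(2) unfolding second_countable_def by blast
  have "U \<in> sets (borel_of X \<Otimes>\<^sub>M borel_of Y)" if U: "openin (prod_topology X Y) U" for U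
  proof -
    let ?I = "{(a, b) \<in> A \<times> B. a \<times> b \<subseteq> U}"
    have "U = (\<Union>p\<in>?I. fst p \<times> snd p)"
    proof
      show "U \<subseteq> (\<Union>p\<in>?I. fst p \<times> snd p)"
      proof clarify
        fix x y assume "(x, y) \<in> U"
        then obtain V W where "openin X V" "openin Y W" "x \<in> V" "y \<in> W" "V \<times> W \<subseteq> U"
          using U unfolding openin_prod_topology_alt by meson
        moreover obtain a b where "a \<in> A" "x \<in> a" "a \<subseteq> V" "b \<in> B" "y \<in> b" "b \<subseteq> W"
          using A(3) B(3) calculation by meson
        ultimately show "(x, y) \<in> (\<Union>p\<in>?I. fst p \<times> snd p)"
          by (intro UN_I[of "(a, b)"]) auto
      qed
    qed auto
    moreover have "countable ?I"
      by (rule countable_subset[of _ "A \<times> B"]) (use A(1) B(1) in auto)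
    moreover have "fst p \<times> snd p \<in> sets (borel_of X \<Otimes>\<^sub>M borel_of Y)" if "p \<in> ?I" for p
      using that A(2) B(2) by (intro pair_measureI openin_in_borel_of) auto
    ultimately show ?thesis
      by (metis (no_types, lifting) sets.countable_UN'')
  qed
  then show "sets (borel_of (prod_topology X Y)) \<subseteq> sets (borel_of X \<Otimes>\<^sub>M borel_of Y)"
    unfolding sets_borel_of[of "prod_topology X Y"]
    using sets.sigma_sets_subset[of "{U. openin (prod_topology X Y) U}" "borel_of X \<Otimes>\<^sub>M borel_of Y"]
    by (auto simp: space_pair_measure)
  have "{a \<times> b |a b. a \<in> sets (borel_of X) \<and> b \<in> sets (borel_of Y)} \<subseteq> sets (borel_of (prod_topology X Y))"
    using sets_borel_of_Times by blast
  from sets.sigma_sets_subset[OF this]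
  show "sets (borel_of X \<Otimes>\<^sub>M borel_of Y) \<subseteq> sets (borel_of (prod_topology X Y))"
    by (simp add: sets_pair_measure)
qed

section \<open>Couplings over a countable algebra\<close>

text \<open>Cauchy-Schwarz in Engel form: clearing denominators leaves
  \<open>0 \<le> (a * w - b * v)\<^sup>2\<close>. The last two assumptions deal with vanishing
  denominators, where the convention \<open>x / 0 = 0\<close> would falsify the inequality.\<close>

lemma square_div_add_le:
  fixes a b v w :: real
  assumes "v \<ge> 0" "w \<ge> 0" "v = 0 \<Longrightarrow> a = 0" "w = 0 \<Longrightarrow> b = 0"
  shows "(a + b)\<^sup>2 / (v + w) \<le> a\<^sup>2 / v + b\<^sup>2 / w"
proof (cases "v = 0 \<or> w = 0")
  case True
  then show ?thesis using assms by auto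
next
  case False
  then have pos: "v > 0" "w > 0" using assms by auto
  have "0 \<le> (a * w - b * v)\<^sup>2" by simp
  then have "(a + b)\<^sup>2 * (v * w) \<le> (a\<^sup>2 * w + b\<^sup>2 * v) * (v + w)"
    by (simp add: power2_eq_square algebra_simps)
  then show ?thesis using pos
    by (simp add: divide_le_eq le_divide_eq add_frac_eq mult.commute)
qed

text \<open>The subsets of \<open>{..<Suc n}\<close> are those of \<open>{..<n}\<close>, with or
  without \<open>n\<close> added. In terms of partitions, each cell of stage \<open>n\<close> is
  split in two by the next set.\<close>

lemma sum_Pow_lessThan_Suc:
  "(\<Sum>J\<in>Pow {..<Suc n}. f J) = (\<Sum>J\<in>Pow {..<n}. f J + f (insert n J))"
proof -
  have "Pow {..<Suc n} = Pow {..<n} \<union> insert n ` Pow {..<n}"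
    by (simp add: lessThan_Suc Pow_insert)
  moreover have "Pow {..<n} \<inter> insert n ` Pow {..<n} = {}" by auto
  moreover have "inj_on (insert n) (Pow {..<n})"
  proof (rule inj_onI)
    fix x y assume "x \<in> Pow {..<n}" "y \<in> Pow {..<n}" "insert n x = insert n y"
    moreover have "n \<notin> x" "n \<notin> y" using calculation by auto
    ultimately show "x = y" by (metis Diff_insert_absorb)
  qed
  ultimately show ?thesis
    by (simp add: sum.union_disjoint sum.reindex sum.distrib)
qed

text \<open>\<open>J\<close> lists the indices below \<open>n\<close> of the sets that contain the
  point. Letting \<open>J\<close> run over all subsets of \<open>{..<n}\<close> yields the partition
  together with some empty blocks, which contribute nothing to the sums.\<close>

definition cell :: "'a set \<Rightarrow> (nat \<Rightarrow> 'a set) \<Rightarrow> nat \<Rightarrow> nat set \<Rightarrow> 'a set" where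
  "cell S D n J = {x \<in> S. \<forall>i<n. x \<in> D i \<longleftrightarrow> i \<in> J}"

lemma Int_cell [simp]: "S \<inter> cell S D n J = cell S D n J"
  unfolding cell_def by blast

lemma cell_sets:
  assumes "\<And>i. D i \<in> sets M"
  shows "cell (space M) D n J \<in> sets M"
proof -
  have "cell (space M) D n J = space M \<inter> (\<Inter>i\<in>{..<n}. if i \<in> J then D i else space M - D i)"
    by (auto simp: cell_def split: if_splits)
  also have "\<dots> \<in> sets M"
  proof (cases "n = 0")
    case False
    then have "(\<Inter>i\<in>{..<n}. if i \<in> J then D i else space M - D i) \<in> sets M"
      using assms by (intro sets.finite_INT) (auto simp: lessThan_empty_iff)
    then show ?thesis by (rule sets.Int[OF sets.top])
  qed simp
  finally show ?thesis .
qed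

lemma cell_Suc:
  assumes "J \<subseteq> {..<n}"
  shows "cell S D n J = cell S D (Suc n) J \<union> cell S D (Suc n) (insert n J)"
    and "cell S D (Suc n) J \<inter> cell S D (Suc n) (insert n J) = {}"
proof -
  have "n \<notin> J" using assms by auto
  then show "cell S D n J = cell S D (Suc n) J \<union> cell S D (Suc n) (insert n J)"
    unfolding cell_def by (auto simp: less_Suc_eq)
  show "cell S D (Suc n) J \<inter> cell S D (Suc n) (insert n J) = {}"
    using \<open>n \<notin> J\<close> by (auto simp: cell_def)
qed

lemma cell_disjoint:
  assumes "J \<in> Pow {..<n}" "J' \<in> Pow {..<n}" "J \<noteq> J'"
  shows "cell S D n J \<inter> cell S D n J' = {}"
proof -
  obtain i where "i < n" "i \<in> J \<longleftrightarrow> i \<notin> J'" using assms by blast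
  then show ?thesis by (auto simp: cell_def)
qed

lemma Union_cells: "(\<Union>J\<in>Pow {..<n}. cell S D n J) = S"
proof
  show "S \<subseteq> (\<Union>J\<in>Pow {..<n}. cell S D n J)"
  proof
    fix x assume "x \<in> S"
    then have "x \<in> cell S D n {i. i < n \<and> x \<in> D i}" by (simp add: cell_def)
    then show "x \<in> (\<Union>J\<in>Pow {..<n}. cell S D n J)" by (rule UN_I[rotated]) auto
  qed
qed (auto simp: cell_def)

lemma (in finite_measure) measure_eq_sum_cells:
  assumes "\<And>i. D i \<in> sets M" "A \<in> sets M"
  shows "measure M A = (\<Sum>J\<in>Pow {..<n}. measure M (A \<inter> cell (space M) D n J))"
proof -
  have "A = (\<Union>J\<in>Pow {..<n}. A \<inter> cell (space M) D n J)"
    using Union_cells[of "space M" D n] sets.sets_into_space[OF assms(2)] by blast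
  then have "measure M A = measure M (\<Union>J\<in>Pow {..<n}. A \<inter> cell (space M) D n J)" by simp
  also have "\<dots> = (\<Sum>J\<in>Pow {..<n}. measure M (A \<inter> cell (space M) D n J))"
  proof (rule finite_measure_finite_Union)
    show "disjoint_family_on (\<lambda>J. A \<inter> cell (space M) D n J) (Pow {..<n})"
      using cell_disjoint[of _ n _ "space M" D] unfolding disjoint_family_on_def by blast
  qed (use assms cell_sets[of D M] in auto)
  finally show ?thesis .
qed

text \<open>The two coordinates are made independent inside each pair of corresponding cells. The
  formula stands outside the locale because \<open>N1\<close> and \<open>N2\<close> will vary with
  the point of the fibre product, and measurability in that point is read off from it.\<close>

definition cell_approx ::
    "'a measure \<Rightarrow> 'b measure \<Rightarrow> (nat \<Rightarrow> 'a set) \<Rightarrow> (nat \<Rightarrow> 'b set) \<Rightarrow> nat \<Rightarrow> 'a set \<Rightarrow> 'b set \<Rightarrow> real" where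
  "cell_approx N1 N2 D1 D2 n A B =
     (\<Sum>J\<in>Pow {..<n}. measure N1 (A \<inter> cell (space N1) D1 n J) * measure N2 (B \<inter> cell (space N2) D2 n J) /
        measure N1 (cell (space N1) D1 n J))"

text \<open>The set algebras generated by \<open>D1\<close> and \<open>D2\<close> play the role of the common quotient: their atoms
  \<open>cell\<close> correspond to each other and carry the same mass.\<close>

locale cell_coupling = N1: finite_measure N1 + N2: finite_measure N2
  for N1 :: "'a measure" and N2 :: "'b measure" +
  fixes D1 :: "nat \<Rightarrow> 'a set" and D2 :: "nat \<Rightarrow> 'b set"
  assumes D1: "\<And>i. D1 i \<in> sets N1" and D2: "\<And>i. D2 i \<in> sets N2"
    and same_mass: "\<And>n J. measure N1 (cell (space N1) D1 n J) = measure N2 (cell (space N2) D2 n J)"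
begin

abbreviation "c1 n J \<equiv> cell (space N1) D1 n J"
abbreviation "c2 n J \<equiv> cell (space N2) D2 n J"

lemma c1_sets [simp]: "c1 n J \<in> sets N1" using D1 by (rule cell_sets)
lemma c2_sets [simp]: "c2 n J \<in> sets N2" using D2 by (rule cell_sets)

abbreviation "approx \<equiv> cell_approx N1 N2 D1 D2"
lemmas approx_def = cell_approx_def[of N1 N2 D1 D2]

text \<open>When the \<open>a n J\<close> are the cell masses of a measure with a density, the sum
  is the squared norm of the conditional expectation of that density given stage \<open>n\<close>.
  It grows under refinement by \<open>square_div_add_le\<close>; the domination of \<open>a\<close>
  by the cell masses makes numerators vanish with their denominators and bounds the sum. The factor
  2 leaves room for a sum of two such families.\<close>

lemma convergent_sum_squares:
  fixes a :: "nat \<Rightarrow> nat set \<Rightarrow> real"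
  assumes split: "\<And>n J. J \<subseteq> {..<n} \<Longrightarrow> a n J = a (Suc n) J + a (Suc n) (insert n J)"
    and a: "\<And>n J. 0 \<le> a n J" "\<And>n J. a n J \<le> 2 * measure N1 (c1 n J)"
  shows "convergent (\<lambda>n. \<Sum>J\<in>Pow {..<n}. (a n J)\<^sup>2 / measure N1 (c1 n J))"
proof -
  let ?v = "\<lambda>n J. measure N1 (c1 n J)"
  let ?f = "\<lambda>n. \<Sum>J\<in>Pow {..<n}. (a n J)\<^sup>2 / ?v n J"
  have "?f n \<le> ?f (Suc n)" for n
    unfolding sum_Pow_lessThan_Suc
  proof (rule sum_mono)
    fix J assume "J \<in> Pow {..<n}"
    then have J: "J \<subseteq> {..<n}" by simp
    have v: "?v n J = ?v (Suc n) J + ?v (Suc n) (insert n J)"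
      unfolding cell_Suc(1)[OF J]
      by (intro N1.finite_measure_Union c1_sets cell_Suc(2)[OF J])
    have "a (Suc n) K = 0" if "?v (Suc n) K = 0" for K
      using a[of "Suc n" K] that by simp
    then show "(a n J)\<^sup>2 / ?v n J \<le> (a (Suc n) J)\<^sup>2 / ?v (Suc n) J + (a (Suc n) (insert n J))\<^sup>2 / ?v (Suc n) (insert n J)"
      unfolding v split[OF J] by (intro square_div_add_le) auto
  qed
  then have "incseq ?f" by (rule incseq_SucI)
  moreover have "?f n \<le> 4 * measure N1 (space N1)" for n
  proof -
    have "?f n \<le> (\<Sum>J\<in>Pow {..<n}. 4 * ?v n J)"
    proof (rule sum_mono)
      fix J
      show "(a n J)\<^sup>2 / ?v n J \<le> 4 * ?v n J"
      proof (cases "?v n J = 0")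
        case False
        then have pos: "?v n J > 0" by (simp add: less_le)
        have "(a n J)\<^sup>2 \<le> (2 * ?v n J)\<^sup>2" using a by (intro power_mono) auto
        then show ?thesis using pos by (simp add: divide_le_eq power2_eq_square mult.assoc)
      qed simp
    qed
    also have "\<dots> = 4 * measure N1 (space N1)"
      using N1.measure_eq_sum_cells[of D1 "space N1" n] D1
      by (simp add: sum_distrib_left)
    finally show ?thesis .
  qed
  ultimately obtain L where "?f \<longlonglongrightarrow> L"
    using incseq_convergent[of ?f] by blast
  then show ?thesis by (rule convergentI)
qed

text \<open>The sequence itself need not be monotone. It is half of
  \<open>(a + b)\<^sup>2 - a\<^sup>2 - b\<^sup>2\<close> summed over the cells with weights, and
  each of the three sums is monotone and bounded.\<close>

lemma convergent_approx:
  assumes "A \<in> sets N1" "B \<in> sets N2"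
  shows "convergent (\<lambda>n. approx n A B)"
proof -
  let ?v = "\<lambda>n J. measure N1 (c1 n J)"
  define a where "a n J = measure N1 (A \<inter> c1 n J)" for n J
  define b where "b n J = measure N2 (B \<inter> c2 n J)" for n J
  have a: "0 \<le> a n J" "a n J \<le> ?v n J" for n J
    unfolding a_def using assms by (auto intro!: N1.finite_measure_mono)
  have b: "0 \<le> b n J" "b n J \<le> ?v n J" for n J
    unfolding b_def same_mass using assms by (auto intro!: N2.finite_measure_mono)
  have as: "a n J = a (Suc n) J + a (Suc n) (insert n J)" if J: "J \<subseteq> {..<n}" for n J
    unfolding a_def cell_Suc(1)[OF J] Int_Un_distrib using assms cell_Suc(2)[OF J, of "space N1" D1]
    by (intro N1.finite_measure_Union) auto
  have bs: "b n J = b (Suc n) J + b (Suc n) (insert n J)" if J: "J \<subseteq> {..<n}" for n J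
    unfolding b_def cell_Suc(1)[OF J] Int_Un_distrib using assms cell_Suc(2)[OF J, of "space N2" D2]
    by (intro N2.finite_measure_Union) auto
  let ?S = "\<lambda>f n. \<Sum>J\<in>Pow {..<n}. (f n J)\<^sup>2 / ?v n J"
  have "convergent (?S (\<lambda>n J. a n J + b n J))"
  proof (rule convergent_sum_squares)
    show "a n J + b n J = (a (Suc n) J + b (Suc n) J) + (a (Suc n) (insert n J) + b (Suc n) (insert n J))"
      if "J \<subseteq> {..<n}" for n J using as[OF that] bs[OF that] by simp
    show "0 \<le> a n J + b n J" "a n J + b n J \<le> 2 * ?v n J" for n J
      using a[of n J] b[of n J] by simp_all
  qed
  moreover have ab2: "a n J \<le> 2 * ?v n J" "b n J \<le> 2 * ?v n J" for n J
    using a[of n J] b[of n J] by simp_all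
  have "convergent (?S a)"
    by (rule convergent_sum_squares[OF as a(1) ab2(1)])
  moreover have "convergent (?S b)"
    by (rule convergent_sum_squares[OF bs b(1) ab2(2)])
  ultimately have "convergent (\<lambda>n. (?S (\<lambda>n J. a n J + b n J) n - ?S a n - ?S b n) * (1/2))"
    by (intro convergent_mult convergent_diff convergent_const)
  also have "(\<lambda>n. (?S (\<lambda>n J. a n J + b n J) n - ?S a n - ?S b n) * (1/2)) = (\<lambda>n. approx n A B)"
  proof
    fix n
    have "?S (\<lambda>n J. a n J + b n J) n - ?S a n - ?S b n =
      (\<Sum>J\<in>Pow {..<n}. (a n J + b n J)\<^sup>2 / ?v n J - (a n J)\<^sup>2 / ?v n J - (b n J)\<^sup>2 / ?v n J)"
      by (simp add: sum_subtractf)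
    also have "\<dots> = (\<Sum>J\<in>Pow {..<n}. 2 * (a n J * b n J / ?v n J))"
      by (intro sum.cong refl) (simp add: power2_sum flip: diff_divide_distrib)
    also have "\<dots> = 2 * approx n A B"
      by (simp add: approx_def a_def b_def sum_distrib_left)
    finally show "(?S (\<lambda>n J. a n J + b n J) n - ?S a n - ?S b n) * (1/2) = approx n A B" by simp
  qed
  finally show ?thesis .
qed

text \<open>In each cell the factor from \<open>N2\<close> cancels the denominator by
  \<open>same_mass\<close>; in a cell of mass 0 both sides vanish. The marginal is exact at every
  stage, not just in the limit, and the compactness estimates below depend on that.\<close>

lemma approx_fst: "A \<in> sets N1 \<Longrightarrow> approx n A (space N2) = measure N1 A"
proof -
  assume A: "A \<in> sets N1"
  have "approx n A (space N2) = (\<Sum>J\<in>Pow {..<n}. measure N1 (A \<inter> c1 n J))"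
    unfolding approx_def
  proof (rule sum.cong[OF refl])
    fix J
    have "measure N1 (A \<inter> c1 n J) \<le> measure N1 (c1 n J)"
      by (intro N1.finite_measure_mono) auto
    then have "measure N1 (c1 n J) = 0 \<Longrightarrow> measure N1 (A \<inter> c1 n J) = 0"
      by (metis measure_le_0_iff)
    then show "measure N1 (A \<inter> c1 n J) * measure N2 (space N2 \<inter> c2 n J) / measure N1 (c1 n J) = measure N1 (A \<inter> c1 n J)"
      by (auto simp: same_mass)
  qed
  then show ?thesis using N1.measure_eq_sum_cells[OF D1 A, where n = n] by simp
qed

lemma approx_snd: "B \<in> sets N2 \<Longrightarrow> approx n (space N1) B = measure N2 B"
proof -
  assume B: "B \<in> sets N2"
  have "approx n (space N1) B = (\<Sum>J\<in>Pow {..<n}. measure N2 (B \<inter> c2 n J))"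
    unfolding approx_def
  proof (rule sum.cong[OF refl])
    fix J
    have "measure N2 (B \<inter> c2 n J) \<le> measure N2 (c2 n J)"
      by (intro N2.finite_measure_mono) auto
    then have "measure N1 (c1 n J) = 0 \<Longrightarrow> measure N2 (B \<inter> c2 n J) = 0"
      by (metis measure_le_0_iff same_mass)
    then show "measure N1 (space N1 \<inter> c1 n J) * measure N2 (B \<inter> c2 n J) / measure N1 (c1 n J) = measure N2 (B \<inter> c2 n J)"
      by auto
  qed
  then show ?thesis using N2.measure_eq_sum_cells[OF D2 B, where n = n] by simp
qed

text \<open>Once \<open>n > i\<close>, corresponding cells lie either inside \<open>D1 i\<close> and
  \<open>D2 i\<close> or outside both, so in every summand one factor is the measure of the empty
  set.\<close>

lemma approx_off_diagonal:
  assumes "i < n"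
  shows "approx n (D1 i) (space N2 - D2 i) = 0" "approx n (space N1 - D1 i) (D2 i) = 0"
proof -
  have "measure N1 (D1 i \<inter> c1 n J) * measure N2 ((space N2 - D2 i) \<inter> c2 n J) / measure N1 (c1 n J) = 0" for J
  proof (cases "i \<in> J")
    case True
    then have "(space N2 - D2 i) \<inter> c2 n J = {}" using assms by (auto simp: cell_def)
    then show ?thesis by simp
  next
    case False
    then have "D1 i \<inter> c1 n J = {}" using assms by (auto simp: cell_def)
    then show ?thesis by simp
  qed
  then show "approx n (D1 i) (space N2 - D2 i) = 0"
    unfolding approx_def by (simp only: sum.neutral_const)
  have "measure N1 ((space N1 - D1 i) \<inter> c1 n J) * measure N2 (D2 i \<inter> c2 n J) / measure N1 (c1 n J) = 0" for J
  proof (cases "i \<in> J")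
    case True
    then have "(space N1 - D1 i) \<inter> c1 n J = {}" using assms by (auto simp: cell_def)
    then show ?thesis by simp
  next
    case False
    then have "D2 i \<inter> c2 n J = {}" using assms by (auto simp: cell_def)
    then show ?thesis by simp
  qed
  then show "approx n (space N1 - D1 i) (D2 i) = 0"
    unfolding approx_def by (simp only: sum.neutral_const)
qed

text \<open>Each pair of corresponding atoms carries the product of the restricted measures, scaled so that the
  marginals stay exact; atoms of mass \<open>0\<close> drop out because \<open>1 / 0 = 0\<close>.\<close>

definition approx_measure :: "nat \<Rightarrow> ('a \<times> 'b) measure" where
  "approx_measure n = density (N1 \<Otimes>\<^sub>M N2)
     (\<lambda>z. \<Sum>J\<in>Pow {..<n}. ennreal (1 / measure N1 (c1 n J)) * indicator (c1 n J \<times> c2 n J) z)"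

lemma sets_approx_measure [simp]: "sets (approx_measure n) = sets (N1 \<Otimes>\<^sub>M N2)"
  by (simp add: approx_measure_def)

lemma space_approx_measure [simp]: "space (approx_measure n) = space N1 \<times> space N2"
  by (simp add: approx_measure_def space_pair_measure)

lemma emeasure_approx_measure_Times:
  assumes "A \<in> sets N1" "B \<in> sets N2"
  shows "emeasure (approx_measure n) (A \<times> B) = ennreal (approx n A B)"
proof -
  have "emeasure (approx_measure n) (A \<times> B) =
     (\<integral>\<^sup>+z. (\<Sum>J\<in>Pow {..<n}. ennreal (1 / measure N1 (c1 n J)) * indicator (c1 n J \<times> c2 n J) z) * indicator (A \<times> B) z \<partial>(N1 \<Otimes>\<^sub>M N2))"
    unfolding approx_measure_def using assms
    by (intro emeasure_density borel_measurable_sum borel_measurable_times_ennreal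
      borel_measurable_const borel_measurable_indicator pair_measureI c1_sets c2_sets)
  also have "\<dots> = (\<integral>\<^sup>+z. (\<Sum>J\<in>Pow {..<n}. ennreal (1 / measure N1 (c1 n J)) * indicator ((A \<inter> c1 n J) \<times> (B \<inter> c2 n J)) z) \<partial>(N1 \<Otimes>\<^sub>M N2))"
    unfolding sum_distrib_right by (intro nn_integral_cong sum.cong refl) (auto simp: indicator_def)
  also have "\<dots> = (\<Sum>J\<in>Pow {..<n}. ennreal (1 / measure N1 (c1 n J)) * emeasure (N1 \<Otimes>\<^sub>M N2) ((A \<inter> c1 n J) \<times> (B \<inter> c2 n J)))"
  proof -
    have R: "(A \<inter> c1 n J) \<times> (B \<inter> c2 n J) \<in> sets (N1 \<Otimes>\<^sub>M N2)" for J
      using assms by (intro pair_measureI sets.Int c1_sets c2_sets)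
    show ?thesis
      by (subst nn_integral_sum)
        (auto intro!: borel_measurable_times_ennreal borel_measurable_indicator R sum.cong
          nn_integral_cmult_indicator)
  qed
  also have "\<dots> = (\<Sum>J\<in>Pow {..<n}. ennreal (measure N1 (A \<inter> c1 n J) * measure N2 (B \<inter> c2 n J) / measure N1 (c1 n J)))"
  proof (rule sum.cong[OF refl])
    fix J
    have "emeasure (N1 \<Otimes>\<^sub>M N2) ((A \<inter> c1 n J) \<times> (B \<inter> c2 n J)) =
        ennreal (measure N1 (A \<inter> c1 n J) * measure N2 (B \<inter> c2 n J))"
      using assms by (subst N2.emeasure_pair_measure_Times)
        (auto simp: N1.emeasure_eq_measure N2.emeasure_eq_measure ennreal_mult)
    then show "ennreal (1 / measure N1 (c1 n J)) * emeasure (N1 \<Otimes>\<^sub>M N2) ((A \<inter> c1 n J) \<times> (B \<inter> c2 n J)) =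
        ennreal (measure N1 (A \<inter> c1 n J) * measure N2 (B \<inter> c2 n J) / measure N1 (c1 n J))"
      by (simp flip: ennreal_mult')
  qed
  also have "\<dots> = ennreal (approx n A B)"
    unfolding approx_def by (rule sum_ennreal) simp
  finally show ?thesis .
qed

lemma finite_measure_approx_measure: "finite_measure (approx_measure n)"
  using emeasure_approx_measure_Times[OF sets.top sets.top, of n]
  by (intro finite_measureI) simp

lemma measure_approx_measure_Times:
  "A \<in> sets N1 \<Longrightarrow> B \<in> sets N2 \<Longrightarrow> measure (approx_measure n) (A \<times> B) = approx n A B"
  using emeasure_approx_measure_Times[of A B n]
  by (simp add: measure_def approx_def sum_nonneg)

section \<open>Passage to the limit on the ring generated by rectangles\<close>

definition rectangles :: "('a \<times> 'b) set set" where
  "rectangles = {A \<times> B |A B. A \<in> sets N1 \<and> B \<in> sets N2}"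

lemma semiring_rectangles: "semiring_of_sets (space N1 \<times> space N2) rectangles"
proof
  show "rectangles \<subseteq> Pow (space N1 \<times> space N2)"
    unfolding rectangles_def by (auto dest!: sets.sets_into_space)
  show "{} \<in> rectangles" unfolding rectangles_def by blast
  fix a b assume "a \<in> rectangles" "b \<in> rectangles"
  then obtain A B C D where
    ab: "a = A \<times> B" "b = C \<times> D" "A \<in> sets N1" "B \<in> sets N2" "C \<in> sets N1" "D \<in> sets N2"
    unfolding rectangles_def by blast
  have "a \<inter> b = (A \<inter> C) \<times> (B \<inter> D)" unfolding ab by blast
  then show "a \<inter> b \<in> rectangles" unfolding rectangles_def using ab by blast
  have "a - b = \<Union>{(A - C) \<times> B, (A \<inter> C) \<times> (B - D)}" unfolding ab by auto
  moreover have "{(A - C) \<times> B, (A \<inter> C) \<times> (B - D)} \<subseteq> rectangles"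
    unfolding rectangles_def using ab by blast
  moreover have "disjoint {(A - C) \<times> B, (A \<inter> C) \<times> (B - D)}"
    unfolding disjoint_def by auto
  ultimately show "\<exists>C\<subseteq>rectangles. finite C \<and> disjoint C \<and> a - b = \<Union> C"
    by (intro exI[of _ "{(A - C) \<times> B, (A \<inter> C) \<times> (B - D)}"]) simp
qed

sublocale rect: semiring_of_sets "space N1 \<times> space N2" rectangles
  by (rule semiring_rectangles)

lemma sets_pair_rectangles: "sets (N1 \<Otimes>\<^sub>M N2) = sigma_sets (space N1 \<times> space N2) rectangles"
  unfolding sets_pair_measure rectangles_def ..

lemma generated_ring_sets: "E \<in> rect.generated_ring \<Longrightarrow> E \<in> sets (N1 \<Otimes>\<^sub>M N2)"
  using sigma_sets.Basic[of E rect.generated_ring "space N1 \<times> space N2"]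
  unfolding rect.sigma_sets_generated_ring_eq sets_pair_rectangles[symmetric] .

text \<open>A member of the ring is a finite disjoint union of rectangles, so its masses are finite
  sums of convergent sequences.\<close>

lemma convergent_approx_measure:
  assumes "E \<in> rect.generated_ring"
  shows "convergent (\<lambda>n. measure (approx_measure n) E)"
proof -
  obtain C where C: "finite C" "disjoint C" "C \<subseteq> rectangles" "E = \<Union>C"
    using assms by (rule rect.generated_ringE)
  have "measure (approx_measure n) E = (\<Sum>c\<in>C. measure (approx_measure n) c)" for n
  proof -
    interpret F: finite_measure "approx_measure n" by (rule finite_measure_approx_measure)
    have "measure (approx_measure n) (\<Union>c\<in>C. c) = (\<Sum>c\<in>C. measure (approx_measure n) c)"
    proof (rule F.finite_measure_finite_Union)
      show "(\<lambda>c. c) ` C \<subseteq> sets (approx_measure n)"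
        using C(3) by (auto simp: rectangles_def)
      show "disjoint_family_on (\<lambda>c. c) C"
        using C(2) by (auto simp: disjoint_family_on_def disjoint_def)
    qed fact
    then show ?thesis using C(4) by simp
  qed
  moreover have "convergent (\<lambda>n. \<Sum>c\<in>C. measure (approx_measure n) c)"
  proof (rule convergent_sum)
    fix c assume "c \<in> C"
    then obtain A B where "c = A \<times> B" "A \<in> sets N1" "B \<in> sets N2"
      using C(3) unfolding rectangles_def by blast
    then show "convergent (\<lambda>n. measure (approx_measure n) c)"
      by (simp add: measure_approx_measure_Times convergent_approx)
  qed
  ultimately show ?thesis by simp
qed

text \<open>Shrinking \<open>A \<times> B\<close> to \<open>A' \<times> B'\<close> loses only points
  of the strips over \<open>A - A'\<close> and \<open>B - B'\<close>. Their masses are marginal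
  masses, the same for every \<open>n\<close>, so one set \<open>F\<close> serves all approximating
  measures.\<close>

lemma compact_approximation:
  fixes e1 :: "'a \<Rightarrow> 'x" and e2 :: "'b \<Rightarrow> 'y"
  assumes reg: "compactly_regular X1 e1 N1" "compactly_regular X2 e2 N2"
    and "E \<in> rect.generated_ring" "\<epsilon> > 0"
  shows "\<exists>F. F \<in> sets (N1 \<Otimes>\<^sub>M N2) \<and> F \<subseteq> E \<and> compactin (prod_topology X1 X2) (map_prod e1 e2 ` F) \<and>
    (\<forall>n. measure (approx_measure n) (E - F) \<le> \<epsilon>)"
proof -
  obtain C where C: "finite C" "C \<subseteq> rectangles" "E = \<Union>C"
    using assms(3) by (elim rect.generated_ringE)
  from C(1,2) \<open>\<epsilon> > 0\<close>
  have "\<exists>F. F \<in> sets (N1 \<Otimes>\<^sub>M N2) \<and> F \<subseteq> \<Union>C \<and> compactin (prod_topology X1 X2) (map_prod e1 e2 ` F) \<and>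
    (\<forall>n. measure (approx_measure n) (\<Union>C - F) \<le> \<epsilon>)"
  proof (induction C arbitrary: \<epsilon> rule: finite_induct)
    case empty
    then show ?case by (intro exI[of _ "{}"]) simp
  next
    case (insert c C)
    \<comment> \<open>Half of \<open>\<epsilon>\<close> goes to the rectangles already treated, a
      quarter to each of the two strips of the new one.\<close>
    have "\<exists>F. F \<in> sets (N1 \<Otimes>\<^sub>M N2) \<and> F \<subseteq> \<Union>C \<and> compactin (prod_topology X1 X2) (map_prod e1 e2 ` F) \<and>
      (\<forall>n. measure (approx_measure n) (\<Union>C - F) \<le> \<epsilon> / 2)"
      using insert.prems by (intro insert.IH) auto
    then obtain F where F: "F \<in> sets (N1 \<Otimes>\<^sub>M N2)" "F \<subseteq> \<Union>C"
      "compactin (prod_topology X1 X2) (map_prod e1 e2 ` F)"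
      "\<And>n. measure (approx_measure n) (\<Union>C - F) \<le> \<epsilon> / 2" by (elim exE conjE) simp
    obtain A B where AB: "c = A \<times> B" "A \<in> sets N1" "B \<in> sets N2"
      using insert.prems unfolding rectangles_def by blast
    obtain A' where A': "A' \<in> sets N1" "A' \<subseteq> A" "measure N1 (A - A') \<le> \<epsilon> / 4" "compactin X1 (e1 ` A')"
      using reg(1)[unfolded compactly_regular_def, rule_format, OF AB(2), of "\<epsilon> / 4"] insert.prems by auto
    obtain B' where B': "B' \<in> sets N2" "B' \<subseteq> B" "measure N2 (B - B') \<le> \<epsilon> / 4" "compactin X2 (e2 ` B')"
      using reg(2)[unfolded compactly_regular_def, rule_format, OF AB(3), of "\<epsilon> / 4"] insert.prems by auto
    let ?F = "F \<union> A' \<times> B'"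
    have c_sets: "c' \<in> sets (N1 \<Otimes>\<^sub>M N2)" if "c' \<in> insert c C" for c'
      using that insert.prems by (auto simp: rectangles_def)
    have "measure (approx_measure n) (\<Union>(insert c C) - ?F) \<le> \<epsilon>" for n
    proof -
      interpret P: finite_measure "approx_measure n" by (rule finite_measure_approx_measure)
      let ?R1 = "(A - A') \<times> space N2" and ?R2 = "space N1 \<times> (B - B')"
      have UC: "\<Union>C - F \<in> sets (approx_measure n)"
        using c_sets F(1) insert.hyps(1) by (auto intro!: sets.Diff sets.finite_Union)
      have R: "?R1 \<in> sets (approx_measure n)" "?R2 \<in> sets (approx_measure n)"
        using AB A' B' by auto
      have "\<Union>(insert c C) - ?F \<subseteq> (\<Union>C - F) \<union> (?R1 \<union> ?R2)"
        using sets.sets_into_space[OF AB(2)] sets.sets_into_space[OF AB(3)] AB(1) by auto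
      then have "measure (approx_measure n) (\<Union>(insert c C) - ?F) \<le> measure (approx_measure n) ((\<Union>C - F) \<union> (?R1 \<union> ?R2))"
        using UC R by (intro P.finite_measure_mono) auto
      also have "\<dots> \<le> measure (approx_measure n) (\<Union>C - F) + measure (approx_measure n) (?R1 \<union> ?R2)"
        using UC R by (intro measure_Un_le) auto
      also have "measure (approx_measure n) (?R1 \<union> ?R2) \<le> measure (approx_measure n) ?R1 + measure (approx_measure n) ?R2"
        using R by (intro measure_Un_le) auto
      also have "measure (approx_measure n) ?R1 = measure N1 (A - A')"
        using AB A' by (simp add: measure_approx_measure_Times approx_fst sets.Diff)
      also have "measure (approx_measure n) ?R2 = measure N2 (B - B')"
        using AB B' by (simp add: measure_approx_measure_Times approx_snd sets.Diff)
      finally show ?thesis using F(4)[of n] A'(3) B'(3) by simp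
    qed
    moreover have "compactin (prod_topology X1 X2) (map_prod e1 e2 ` ?F)"
    proof -
      have "map_prod e1 e2 ` (A' \<times> B') = (e1 ` A') \<times> (e2 ` B')" by auto
      then have "compactin (prod_topology X1 X2) (map_prod e1 e2 ` (A' \<times> B'))"
        using A'(4) B'(4) by (simp add: compactin_Times)
      then show ?thesis unfolding image_Un using F(3) by (intro compactin_Un)
    qed
    moreover have "?F \<in> sets (N1 \<Otimes>\<^sub>M N2)" using F(1) A'(1) B'(1) by auto
    moreover have "?F \<subseteq> \<Union>(insert c C)" using F(2) A'(2) B'(2) AB(1) by auto
    ultimately show ?case by (intro exI[of _ ?F] conjI allI)
  qed
  then show ?thesis unfolding C(3) .
qed

text \<open>Each \<open>E i\<close> contains an \<open>F i\<close> with compact image, missing mass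
  at most \<open>\<epsilon> * (1/2) ^ Suc i\<close>. The \<open>F i\<close> have empty intersection,
  so by compactness finitely many of them already do; from then on \<open>E k\<close> consists of
  missed points only.\<close>

lemma approx_measure_vanishes:
  fixes e1 :: "'a \<Rightarrow> 'x" and e2 :: "'b \<Rightarrow> 'y"
  assumes reg: "compactly_regular X1 e1 N1" "compactly_regular X2 e2 N2"
    and X: "Hausdorff_space X1" "Hausdorff_space X2"
    and inj: "inj_on e1 (space N1)" "inj_on e2 (space N2)"
    and E: "range E \<subseteq> rect.generated_ring" "decseq E" "(\<Inter>i. E i) = {}"
    and "\<epsilon> > 0"
  shows "\<exists>k. \<forall>n. measure (approx_measure n) (E k) \<le> \<epsilon>"
proof -
  let ?X = "prod_topology X1 X2"
  define e where "e = map_prod e1 e2"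
  have E_ring: "E i \<in> rect.generated_ring" for i using E(1) by blast
  have "\<forall>i. \<exists>F. F \<in> sets (N1 \<Otimes>\<^sub>M N2) \<and> F \<subseteq> E i \<and> compactin ?X (e ` F) \<and>
      (\<forall>n. measure (approx_measure n) (E i - F) \<le> \<epsilon> * (1/2) ^ Suc i)"
    using \<open>\<epsilon> > 0\<close> by (intro allI compact_approximation[OF reg, folded e_def] E_ring) simp
  from choice[OF this] obtain F where F': "\<forall>i. F i \<in> sets (N1 \<Otimes>\<^sub>M N2) \<and> F i \<subseteq> E i \<and> compactin ?X (e ` F i) \<and>
      (\<forall>n. measure (approx_measure n) (E i - F i) \<le> \<epsilon> * (1/2) ^ Suc i)" ..
  have F: "F i \<in> sets (N1 \<Otimes>\<^sub>M N2)" "F i \<subseteq> E i" "compactin ?X (e ` F i)"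
    and Fm: "measure (approx_measure n) (E i - F i) \<le> \<epsilon> * (1/2) ^ Suc i" for i n
    using F'[rule_format, of i] by simp_all
  have F_sub: "F i \<subseteq> space N1 \<times> space N2" for i
    using sets.sets_into_space[OF F(1)] by (simp add: space_pair_measure)
  have inj_e: "inj_on e (space N1 \<times> space N2)"
    using inj unfolding e_def by (intro map_prod_inj_on)
  have "Hausdorff_space ?X" using X by (simp add: Hausdorff_space_prod_topology)
  then have K_closed: "closedin ?X (e ` F i)" for i
    using F(3) by (rule compactin_imp_closedin)
  have F_empty: "(\<Inter>i. F i) = {}"
  proof (rule equals0I)
    fix x assume "x \<in> (\<Inter>i. F i)"
    then have "x \<in> E i" for i using F(2)[of i] by blast
    then have "x \<in> (\<Inter>i. E i)" by (rule INT_I)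
    then show False using E(3) by simp
  qed
  \<comment> \<open>Injectivity of \<open>e\<close> transfers the empty intersection from the sets
    \<open>F i\<close> to their images, whose complements therefore form an open cover of the
    compact image of \<open>F 0\<close>.\<close>
  have "e ` F 0 \<subseteq> \<Union>(range (\<lambda>i. topspace ?X - e ` F i))"
  proof
    fix z assume z: "z \<in> e ` F 0"
    then obtain x where x: "z = e x" "x \<in> F 0" by (rule imageE)
    have "x \<notin> (\<Inter>i. F i)" using F_empty by simp
    then obtain i where "x \<notin> F i" by auto
    then have "z \<notin> e ` F i"
      unfolding x(1) using inj_on_image_mem_iff[OF inj_e subsetD[OF F_sub x(2)] F_sub] by simp
    then show "z \<in> \<Union>(range (\<lambda>i. topspace ?X - e ` F i))"
      using z compactin_subset_topspace[OF F(3)] by blast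
  qed
  moreover have "\<forall>U\<in>range (\<lambda>i. topspace ?X - e ` F i). openin ?X U"
    using K_closed by blast
  ultimately obtain \<U> where \<U>: "finite \<U>" "\<U> \<subseteq> range (\<lambda>i. topspace ?X - e ` F i)" "e ` F 0 \<subseteq> \<Union>\<U>"
    using F(3)[of 0] unfolding compactin_def by meson
  obtain I where I: "finite I" "\<U> = (\<lambda>i. topspace ?X - e ` F i) ` I"
    using finite_subset_image[OF \<U>(1,2)] by blast
  obtain k where k: "\<forall>i\<in>I. i < k" using I(1) finite_nat_set_iff_bounded by blast
  \<comment> \<open>A point outside \<open>F 0\<close> is caught by the index 0. A point of
    \<open>F 0\<close> misses some \<open>F i\<close> with \<open>i \<in> I\<close>, and since
    \<open>i < k\<close> it still belongs to \<open>E i\<close>.\<close>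
  have "E k \<subseteq> (\<Union>i\<in>{..k}. E i - F i)"
  proof
    fix x assume x: "x \<in> E k"
    then have xE: "x \<in> E i" if "i \<le> k" for i using E(2) that by (auto simp: decseq_def)
    show "x \<in> (\<Union>i\<in>{..k}. E i - F i)"
    proof (cases "x \<in> F 0")
      case True
      then have "e x \<in> \<Union>\<U>" using \<U>(3) by blast
      then obtain i where "i \<in> I" "e x \<notin> e ` F i" unfolding I(2) by blast
      then show ?thesis using k xE[of i] by (intro UN_I[of i]) auto
    next
      case False
      then show ?thesis using xE[of 0] by (intro UN_I[of 0]) auto
    qed
  qed
  have "measure (approx_measure n) (E k) \<le> \<epsilon>" for n
  proof -
    interpret P: finite_measure "approx_measure n" by (rule finite_measure_approx_measure)
    have EF: "E i - F i \<in> sets (approx_measure n)" for i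
      using generated_ring_sets[OF E_ring] F(1) by auto
    have "measure (approx_measure n) (E k) \<le> measure (approx_measure n) (\<Union>i\<in>{..k}. E i - F i)"
      using EF by (intro P.finite_measure_mono \<open>E k \<subseteq> _\<close> sets.finite_UN) auto
    also have "\<dots> \<le> (\<Sum>i\<in>{..k}. measure (approx_measure n) (E i - F i))"
      using EF by (intro P.finite_measure_subadditive_finite) auto
    also have "\<dots> \<le> (\<Sum>i\<in>{..k}. \<epsilon> * (1/2) ^ Suc i)"
      by (intro sum_mono Fm)
    also have "\<dots> = \<epsilon> * (1 - (1/2) ^ Suc k)"
      by (induction k) (simp_all add: algebra_simps)
    also have "\<dots> \<le> \<epsilon>" using \<open>\<epsilon> > 0\<close> by (simp add: algebra_simps)
    finally show ?thesis .
  qed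
  then show ?thesis by blast
qed

text \<open>Caratheodory extension from the ring. The limit is additive because every approximating
  measure is, and continuous at the empty set because \<open>approx_measure_vanishes\<close> bounds
  all of them at once. The conclusion records the limit on rectangles, as marginals, null rectangles
  and measurability are all derived from it.\<close>

theorem coupling_exists:
  fixes e1 :: "'a \<Rightarrow> 'x" and e2 :: "'b \<Rightarrow> 'y"
  assumes reg: "compactly_regular X1 e1 N1" "compactly_regular X2 e2 N2"
    and X: "Hausdorff_space X1" "Hausdorff_space X2"
    and inj: "inj_on e1 (space N1)" "inj_on e2 (space N2)"
  shows "\<exists>\<mu>. sets \<mu> = sets (N1 \<Otimes>\<^sub>M N2) \<and>
    (\<forall>A\<in>sets N1. \<forall>B\<in>sets N2. (\<lambda>n. ennreal (approx n A B)) \<longlonglongrightarrow> emeasure \<mu> (A \<times> B))"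
proof -
  let ?\<Omega> = "space N1 \<times> space N2" and ?G = "rect.generated_ring"
  interpret G: ring_of_sets ?\<Omega> ?G by (rule rect.generating_ring)
  define l where "l E = lim (\<lambda>n. measure (approx_measure n) E)" for E
  have l: "(\<lambda>n. measure (approx_measure n) E) \<longlonglongrightarrow> l E" if "E \<in> ?G" for E
    unfolding l_def using convergent_approx_measure[OF that] by (simp add: convergent_LIMSEQ_iff)
  have l_nonneg: "0 \<le> l E" if "E \<in> ?G" for E
    using l[OF that] by (rule LIMSEQ_le_const) simp
  have l_le: "l E \<le> b" if "E \<in> ?G" "\<And>n. measure (approx_measure n) E \<le> b" for E b
    using l[OF that(1)] by (rule LIMSEQ_le_const2) (use that(2) in blast)
  have l_Un: "l (E \<union> F) = l E + l F" if "E \<in> ?G" "F \<in> ?G" "E \<inter> F = {}" for E F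
  proof (rule LIMSEQ_unique)
    show "(\<lambda>n. measure (approx_measure n) (E \<union> F)) \<longlonglongrightarrow> l (E \<union> F)"
      using that by (intro l G.Un)
    have "measure (approx_measure n) (E \<union> F) = measure (approx_measure n) E + measure (approx_measure n) F" for n
      using generated_ring_sets that
      by (intro finite_measure.finite_measure_Union[OF finite_measure_approx_measure]) auto
    then show "(\<lambda>n. measure (approx_measure n) (E \<union> F)) \<longlonglongrightarrow> l E + l F"
      using tendsto_add[OF l[OF that(1)] l[OF that(2)]] by simp
  qed
  have "\<exists>\<mu>. (\<forall>E\<in>?G. \<mu> E = ennreal (l E)) \<and> measure_space ?\<Omega> (sigma_sets ?\<Omega> ?G) \<mu>"
  proof (rule G.caratheodory_empty_continuous)
    show "positive ?G (\<lambda>E. ennreal (l E))"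
      by (simp add: positive_def l_def)
    show "additive ?G (\<lambda>E. ennreal (l E))"
      unfolding additive_def using l_Un l_nonneg by (simp add: ennreal_plus)
    fix E assume E: "range E \<subseteq> ?G" "decseq E" "(\<Inter>i. E i) = {}"
    have "(\<lambda>i. l (E i)) \<longlonglongrightarrow> 0"
    proof (rule LIMSEQ_I)
      fix r :: real assume "r > 0"
      \<comment> \<open>\<open>r / 2\<close> because the limit preserves only weak inequalities,
        while a strict one is required.\<close>
      then obtain k where k: "\<And>n. measure (approx_measure n) (E k) \<le> r / 2"
        using approx_measure_vanishes[OF reg X inj E, of "r / 2"] by auto
      have "norm (l (E i) - 0) < r" if "k \<le> i" for i
      proof -
        have "measure (approx_measure n) (E i) \<le> r / 2" for n
        proof -
          have "E k \<in> sets (approx_measure n)"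
            using generated_ring_sets[of "E k"] E(1) by auto
          moreover have "E i \<subseteq> E k" using E(2) that by (simp add: decseq_def)
          ultimately have "measure (approx_measure n) (E i) \<le> measure (approx_measure n) (E k)"
            by (intro finite_measure.finite_measure_mono[OF finite_measure_approx_measure])
          then show ?thesis using k[of n] by simp
        qed
        moreover have "E i \<in> ?G" using E(1) by blast
        ultimately have "l (E i) \<le> r / 2" "0 \<le> l (E i)" using l_le l_nonneg by blast+
        then show ?thesis using \<open>r > 0\<close> by auto
      qed
      then show "\<exists>k. \<forall>i\<ge>k. norm (l (E i) - 0) < r" by blast
    qed
    then show "(\<lambda>i. ennreal (l (E i))) \<longlonglongrightarrow> 0"
      using tendsto_ennrealI by fastforce
  qed simp
  then obtain \<mu> where \<mu>: "\<forall>E\<in>?G. \<mu> E = ennreal (l E)" "measure_space ?\<Omega> (sigma_sets ?\<Omega> ?G) \<mu>"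
    by blast
  define m where "m = measure_of ?\<Omega> (sigma_sets ?\<Omega> ?G) \<mu>"
  have sets_eq: "sigma_sets ?\<Omega> ?G = sets (N1 \<Otimes>\<^sub>M N2)"
    unfolding rect.sigma_sets_generated_ring_eq sets_pair_rectangles ..
  have "sets m = sets (N1 \<Otimes>\<^sub>M N2)"
    unfolding m_def using \<mu>(2) sets_eq
    by (metis measure_space_def sigma_algebra.sets_measure_of_eq)
  moreover have "(\<lambda>n. ennreal (approx n A B)) \<longlonglongrightarrow> emeasure m (A \<times> B)"
    if AB: "A \<in> sets N1" "B \<in> sets N2" for A B
  proof -
    have G: "A \<times> B \<in> ?G" using AB by (intro rect.generated_ringI_Basic) (auto simp: rectangles_def)
    have "emeasure m (A \<times> B) = \<mu> (A \<times> B)"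
      unfolding m_def using \<mu>(2) G
      by (intro emeasure_measure_of_sigma) (auto simp: measure_space_def)
    also have "\<dots> = ennreal (l (A \<times> B))" using \<mu>(1) G by blast
    finally show ?thesis
      using tendsto_ennrealI[OF l[OF G]] AB by (simp add: measure_approx_measure_Times)
  qed
  ultimately show ?thesis by blast
qed

end

section \<open>Kernels on fibre products\<close>

lemma coanalytic_embedding_restrict_space:
  assumes e: "coanalytic_embedding M X e" and S: "S \<in> sets M"
  shows "coanalytic_embedding (restrict_space M S) X e"
proof -
  note X = coanalytic_embeddingD(1)[OF e] and inj = coanalytic_embeddingD(2)[OF e]
    and im = coanalytic_embeddingD(3)[OF e] and A = coanalytic_embeddingD(4)[OF e]
    and setsM = coanalytic_embeddingD(5)[OF e]
  have SM: "S \<subseteq> space M" using sets.sets_into_space[OF S] .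
  have space_S: "space (restrict_space M S) = S" using S by (rule space_restrict_space2)
  obtain B where B: "B \<in> sets (borel_of X)" "S = e -` B \<inter> space M" using S unfolding setsM by blast
  \<comment> \<open>Restriction to \<open>S\<close> adds to the complement of the image only the
    Borel set \<open>topspace X - B\<close>, and Borel sets are analytic.\<close>
  have "topspace X - B \<in> sets (borel_of X)" using B(1) sets.compl_sets by fastforce
  with A have "analytic_in X ((topspace X - e ` space M) \<union> (topspace X - B))"
    by (rule analytic_in_Un[OF _ borel_of_imp_analytic_in[OF X]])
  moreover have "(topspace X - e ` space M) \<union> (topspace X - B) = topspace X - e ` S"
    unfolding B(2) by blast
  ultimately have "analytic_in X (topspace X - e ` S)" by simp
  moreover have "sets (restrict_space M S) = (\<lambda>B. e -` B \<inter> S) ` sets (borel_of X)"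
  proof -
    have "S \<inter> (e -` B \<inter> space M) = e -` B \<inter> S" for B using SM by blast
    then show ?thesis unfolding sets_restrict_space setsM image_image by simp
  qed
  moreover have "inj_on e S" using inj SM by (rule inj_on_subset)
  moreover have "e ` S \<subseteq> topspace X" using im SM by blast
  ultimately show ?thesis
    unfolding coanalytic_embedding_def space_S using X by (intro conjI)
qed

text \<open>The complement of a product of two images is the union of two strips, each the product
  of an analytic set with a whole factor. The sigma-algebras match because the ambient spaces are
  second countable.\<close>

lemma coanalytic_embedding_pair_measure:
  assumes e1: "coanalytic_embedding M1 X1 e1" and e2: "coanalytic_embedding M2 X2 e2"
  shows "coanalytic_embedding (M1 \<Otimes>\<^sub>M M2) (prod_topology X1 X2) (map_prod e1 e2)"
proof -
  note X = coanalytic_embeddingD(1)[OF e1] coanalytic_embeddingD(1)[OF e2]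
  note inj = coanalytic_embeddingD(2)[OF e1] coanalytic_embeddingD(2)[OF e2]
  note im = coanalytic_embeddingD(3)[OF e1] coanalytic_embeddingD(3)[OF e2]
  note A = coanalytic_embeddingD(4)[OF e1] coanalytic_embeddingD(4)[OF e2]
  note sets1 = coanalytic_embeddingD(5)[OF e1] and sets2 = coanalytic_embeddingD(5)[OF e2]
  let ?X = "prod_topology X1 X2" and ?M = "M1 \<Otimes>\<^sub>M M2" and ?\<Omega> = "space M1 \<times> space M2"
  let ?e = "map_prod e1 e2"
  have sp: "space ?M = ?\<Omega>" by (simp add: space_pair_measure)
  have "Polish_space ?X" using X by (rule Polish_space_prod_topology)
  moreover have "inj_on ?e ?\<Omega>" using inj by (rule map_prod_inj_on)
  moreover have e_image: "?e ` ?\<Omega> = (e1 ` space M1) \<times> (e2 ` space M2)"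
    by (rule map_prod_surj_on) auto
  then have "?e ` ?\<Omega> \<subseteq> topspace ?X" using Sigma_mono[OF im(1) im(2)] by simp
  moreover have "analytic_in ?X (topspace ?X - ?e ` ?\<Omega>)"
  proof -
    have "analytic_in ?X ((topspace X1 - e1 ` space M1) \<times> topspace X2 \<union>
        topspace X1 \<times> (topspace X2 - e2 ` space M2))"
      using A X by (intro analytic_in_Un analytic_in_Times) (auto intro: analytic_in_closedin)
    also have "(topspace X1 - e1 ` space M1) \<times> topspace X2 \<union> topspace X1 \<times> (topspace X2 - e2 ` space M2) =
        topspace ?X - (e1 ` space M1) \<times> (e2 ` space M2)"
      by auto
    finally show ?thesis unfolding e_image .
  qed
  moreover have "sets ?M = (\<lambda>B. ?e -` B \<inter> ?\<Omega>) ` sets (borel_of ?X)"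
  proof
    have e: "?e \<in> ?\<Omega> \<rightarrow> space (borel_of ?X)" using im[THEN subsetD, OF imageI] by auto
    have V: "sets (vimage_algebra ?\<Omega> ?e (borel_of ?X)) = (\<lambda>B. ?e -` B \<inter> ?\<Omega>) ` sets (borel_of ?X)"
      using sets_vimage_algebra2[OF e] by blast
    have "{a \<times> b |a b. a \<in> sets M1 \<and> b \<in> sets M2} \<subseteq> sets (vimage_algebra ?\<Omega> ?e (borel_of ?X))"
      unfolding V
    proof clarify
      fix a b assume "a \<in> sets M1" "b \<in> sets M2"
      then obtain a' b' where ab: "a' \<in> sets (borel_of X1)" "a = e1 -` a' \<inter> space M1"
        "b' \<in> sets (borel_of X2)" "b = e2 -` b' \<inter> space M2"
        unfolding sets1 sets2 by blast
      have "a \<times> b = ?e -` (a' \<times> b') \<inter> ?\<Omega>" unfolding ab by auto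
      then show "a \<times> b \<in> (\<lambda>B. ?e -` B \<inter> ?\<Omega>) ` sets (borel_of ?X)"
        using sets_borel_of_Times[OF ab(1,3)] by (rule image_eqI)
    qed
    from sets.sigma_sets_subset[OF this]
    show "sets ?M \<subseteq> (\<lambda>B. ?e -` B \<inter> ?\<Omega>) ` sets (borel_of ?X)"
      unfolding V[symmetric] sets_pair_measure by simp
    have "?e \<in> measurable ?M (borel_of X1 \<Otimes>\<^sub>M borel_of X2)"
      unfolding map_prod_def
      using coanalytic_embedding_measurable[OF e1] coanalytic_embedding_measurable[OF e2] by measurable
    moreover have "sets (borel_of X1 \<Otimes>\<^sub>M borel_of X2) = sets (borel_of ?X)"
      using X by (intro sets_borel_of_prod_topology[symmetric]) (simp_all add: Polish_space_iff_second_countable)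
    ultimately show "(\<lambda>B. ?e -` B \<inter> ?\<Omega>) ` sets (borel_of ?X) \<subseteq> sets ?M"
      using measurable_sets[of ?e ?M "borel_of X1 \<Otimes>\<^sub>M borel_of X2"] unfolding sp by blast
  qed
  ultimately show ?thesis
    unfolding coanalytic_embedding_def sp by (intro conjI)
qed

section \<open>The fibre product and its kernels\<close>

lemma cell_vimage:
  assumes "h \<in> measurable M N"
  shows "cell (space M) (\<lambda>i. h -` C i \<inter> space M) n J = h -` cell (space N) C n J \<inter> space M"
  using measurable_space[OF assms] by (auto simp: cell_def)

lemma fibre_product_sets:
  assumes h: "h1 \<in> measurable M1 M0" "h2 \<in> measurable M2 M0"
    and C: "\<And>i::nat. C i \<in> sets M0"
      "\<forall>x\<in>space M0. \<forall>y\<in>space M0. (\<forall>i. x \<in> C i \<longleftrightarrow> y \<in> C i) \<longrightarrow> x = y"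
  defines "D1 \<equiv> \<lambda>i. h1 -` C i \<inter> space M1" and "D2 \<equiv> \<lambda>i. h2 -` C i \<inter> space M2"
  defines "\<Delta> \<equiv> {z \<in> space M1 \<times> space M2. h1 (fst z) = h2 (snd z)}"
  shows "space M1 \<times> space M2 - \<Delta> = (\<Union>i. D1 i \<times> (space M2 - D2 i) \<union> (space M1 - D1 i) \<times> D2 i)"
    and "D1 i \<in> sets M1" and "D2 i \<in> sets M2" and "\<Delta> \<in> sets (M1 \<Otimes>\<^sub>M M2)"
proof -
  show D: "D1 i \<in> sets M1" "D2 i \<in> sets M2" for i
    unfolding D1_def D2_def using h C(1) by (auto intro: measurable_sets)
  show eq: "space M1 \<times> space M2 - \<Delta> = (\<Union>i. D1 i \<times> (space M2 - D2 i) \<union> (space M1 - D1 i) \<times> D2 i)"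
  proof
    show "space M1 \<times> space M2 - \<Delta> \<subseteq> (\<Union>i. D1 i \<times> (space M2 - D2 i) \<union> (space M1 - D1 i) \<times> D2 i)"
    proof clarify
      fix x y assume xy: "x \<in> space M1" "y \<in> space M2" "(x, y) \<notin> \<Delta>"
      then have "h1 x \<noteq> h2 y" by (simp add: \<Delta>_def)
      then obtain i where "(h1 x \<in> C i) \<noteq> (h2 y \<in> C i)"
        using C(2)[rule_format, of "h1 x" "h2 y"] measurable_space[OF h(1) xy(1)] measurable_space[OF h(2) xy(2)] by blast
      then show "(x, y) \<in> (\<Union>i. D1 i \<times> (space M2 - D2 i) \<union> (space M1 - D1 i) \<times> D2 i)"
        using xy by (intro UN_I[of i]) (auto simp: D1_def D2_def)
    qed
    show "(\<Union>i. D1 i \<times> (space M2 - D2 i) \<union> (space M1 - D1 i) \<times> D2 i) \<subseteq> space M1 \<times> space M2 - \<Delta>"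
      by (auto simp: D1_def D2_def \<Delta>_def)
  qed
  have "\<Delta> = space (M1 \<Otimes>\<^sub>M M2) - (space M1 \<times> space M2 - \<Delta>)"
    by (auto simp: space_pair_measure \<Delta>_def)
  also have "\<dots> \<in> sets (M1 \<Otimes>\<^sub>M M2)"
    unfolding eq using D by (intro sets.Diff sets.top sets.countable_UN) auto
  finally show "\<Delta> \<in> sets (M1 \<Otimes>\<^sub>M M2)" .
qed

lemma cell_approx_eq:
  assumes "sets N1 = sets M1" "sets N2 = sets M2"
  shows "cell_approx N1 N2 D1 D2 n A B =
     (\<Sum>J\<in>Pow {..<n}. measure N1 (A \<inter> cell (space M1) D1 n J) * measure N2 (B \<inter> cell (space M2) D2 n J) /
        measure N1 (cell (space M1) D1 n J))"
  unfolding cell_approx_def sets_eq_imp_space_eq[OF assms(1)] sets_eq_imp_space_eq[OF assms(2)] ..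

lemma fibre_product_kernel:
  fixes h1 :: "'a \<Rightarrow> 'c" and h2 :: "'b \<Rightarrow> 'c" and X1 :: "'x topology" and X2 :: "'y topology"
  assumes e1: "coanalytic_embedding M1 X1 e1" and e2: "coanalytic_embedding M2 X2 e2"
    and h: "h1 \<in> measurable M1 M0" "h2 \<in> measurable M2 M0"
    and C: "\<And>i::nat. C i \<in> sets M0"
      "\<forall>x\<in>space M0. \<forall>y\<in>space M0. (\<forall>i. x \<in> C i \<longleftrightarrow> y \<in> C i) \<longrightarrow> x = y"
    and t: "t1 \<in> measurable M1 (subprob_algebra M1)" "t2 \<in> measurable M2 (subprob_algebra M2)"
    and t_h: "\<And>x y Q. x \<in> space M1 \<Longrightarrow> y \<in> space M2 \<Longrightarrow> h1 x = h2 y \<Longrightarrow> Q \<in> sets M0 \<Longrightarrow>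
      emeasure (t1 x) (h1 -` Q \<inter> space M1) = emeasure (t2 y) (h2 -` Q \<inter> space M2)"
  defines "\<Delta> \<equiv> {z \<in> space M1 \<times> space M2. h1 (fst z) = h2 (snd z)}"
  shows "\<exists>t. t \<in> measurable (restrict_space (M1 \<Otimes>\<^sub>M M2) \<Delta>) (subprob_algebra (restrict_space (M1 \<Otimes>\<^sub>M M2) \<Delta>)) \<and>
    (\<forall>z\<in>\<Delta>. (\<forall>A\<in>sets M1. emeasure (t z) (fst -` A \<inter> \<Delta>) = emeasure (t1 (fst z)) A) \<and>
       (\<forall>B\<in>sets M2. emeasure (t z) (snd -` B \<inter> \<Delta>) = emeasure (t2 (snd z)) B))"
proof -
  let ?P = "M1 \<Otimes>\<^sub>M M2"
  let ?S = "restrict_space ?P \<Delta>"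
  define D1 where "D1 i = h1 -` C i \<inter> space M1" for i
  define D2 where "D2 i = h2 -` C i \<inter> space M2" for i
  note fps = fibre_product_sets[OF h C, folded D1_def D2_def \<Delta>_def]
  note off = fps(1) and D = fps(2,3) and \<Delta> = fps(4)
  have space_S: "space ?S = \<Delta>" using \<Delta> by (rule space_restrict_space2)
  have \<Delta>_sub: "\<Delta> \<subseteq> space M1 \<times> space M2" unfolding \<Delta>_def by blast
  have t1: "sets (t1 x) = sets M1" "space (t1 x) = space M1" "subprob_space (t1 x)" if "x \<in> space M1" for x
    using measurable_space[OF t(1) that] by (auto simp: space_subprob_algebra dest: sets_eq_imp_space_eq)
  have t2: "sets (t2 y) = sets M2" "space (t2 y) = space M2" "subprob_space (t2 y)" if "y \<in> space M2" for y
    using measurable_space[OF t(2) that] by (auto simp: space_subprob_algebra dest: sets_eq_imp_space_eq)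
  let ?Q = "\<lambda>z n A B. cell_approx (t1 (fst z)) (t2 (snd z)) D1 D2 n A B"
  \<comment> \<open>The arbitrary choice does no damage: for \<open>z \<in> \<Delta>\<close> the
    condition fixes the values on rectangles, and those determine a finite measure on the
    product.\<close>
  define K where "K z = (SOME \<mu>. sets \<mu> = sets ?P \<and>
    (\<forall>A\<in>sets M1. \<forall>B\<in>sets M2. (\<lambda>n. ennreal (?Q z n A B)) \<longlonglongrightarrow> emeasure \<mu> (A \<times> B)))" for z
  have coupling: "cell_coupling (t1 (fst z)) (t2 (snd z)) D1 D2" if "z \<in> \<Delta>" for z
  proof -
    have z: "fst z \<in> space M1" "snd z \<in> space M2" "h1 (fst z) = h2 (snd z)"
      using that by (auto simp: \<Delta>_def)
    interpret N1: subprob_space "t1 (fst z)" using t1[OF z(1)] by simp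
    interpret N2: subprob_space "t2 (snd z)" using t2[OF z(2)] by simp
    show ?thesis
    proof
      show "D1 i \<in> sets (t1 (fst z))" "D2 i \<in> sets (t2 (snd z))" for i
        using D t1[OF z(1)] t2[OF z(2)] by simp_all
      \<comment> \<open>Corresponding cells are preimages of one and the same cell of the base, to
        which \<open>t_h\<close> applies.\<close>
      show "measure (t1 (fst z)) (cell (space (t1 (fst z))) D1 n J) =
          measure (t2 (snd z)) (cell (space (t2 (snd z))) D2 n J)" for n J
        unfolding t1(2)[OF z(1)] t2(2)[OF z(2)]
        unfolding D1_def D2_def cell_vimage[OF h(1)] cell_vimage[OF h(2)]
        by (simp add: measure_def t_h[OF z cell_sets[OF C(1)]])
    qed
  qed
  have K: "sets (K z) = sets ?P"
    "A \<in> sets M1 \<Longrightarrow> B \<in> sets M2 \<Longrightarrow> (\<lambda>n. ennreal (?Q z n A B)) \<longlonglongrightarrow> emeasure (K z) (A \<times> B)"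
    if "z \<in> \<Delta>" for z A B
  proof -
    have z: "fst z \<in> space M1" "snd z \<in> space M2" using that by (auto simp: \<Delta>_def)
    interpret N1: subprob_space "t1 (fst z)" using t1[OF z(1)] by simp
    interpret N2: subprob_space "t2 (snd z)" using t2[OF z(2)] by simp
    interpret cell_coupling "t1 (fst z)" "t2 (snd z)" D1 D2 using coupling[OF that] .
    have "sets (t1 (fst z) \<Otimes>\<^sub>M t2 (snd z)) = sets ?P"
      by (rule sets_pair_measure_cong[OF t1(1)[OF z(1)] t2(1)[OF z(2)]])
    then have "\<exists>\<mu>. sets \<mu> = sets ?P \<and>
        (\<forall>A\<in>sets M1. \<forall>B\<in>sets M2. (\<lambda>n. ennreal (?Q z n A B)) \<longlonglongrightarrow> emeasure \<mu> (A \<times> B))"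
      using coupling_exists[of X1 e1 X2 e2]
        coanalytic_embedding_compactly_regular[OF e1 N1.finite_measure_axioms t1(1)[OF z(1)]]
        coanalytic_embedding_compactly_regular[OF e2 N2.finite_measure_axioms t2(1)[OF z(2)]]
        coanalytic_embeddingD(1,2)[OF e1] coanalytic_embeddingD(1,2)[OF e2]
      by (simp add: Polish_space_imp_Hausdorff_space t1[OF z(1)] t2[OF z(2)])
    from someI_ex[OF this, folded K_def]
    show "sets (K z) = sets ?P"
      "A \<in> sets M1 \<Longrightarrow> B \<in> sets M2 \<Longrightarrow> (\<lambda>n. ennreal (?Q z n A B)) \<longlonglongrightarrow> emeasure (K z) (A \<times> B)"
      by blast+
  qed
  have K_fst: "emeasure (K z) (A \<times> space M2) = emeasure (t1 (fst z)) A" if z: "z \<in> \<Delta>" and A: "A \<in> sets M1" for z A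
  proof -
    have zs: "fst z \<in> space M1" "snd z \<in> space M2" using z by (auto simp: \<Delta>_def)
    interpret cell_coupling "t1 (fst z)" "t2 (snd z)" D1 D2 using coupling[OF z] .
    have "(\<lambda>n. ennreal (?Q z n A (space M2))) = (\<lambda>n. emeasure (t1 (fst z)) A)"
      using approx_fst[of A] A t1[OF zs(1)] t2[OF zs(2)] by (simp add: N1.emeasure_eq_measure)
    then have "(\<lambda>n. ennreal (?Q z n A (space M2))) \<longlonglongrightarrow> emeasure (t1 (fst z)) A" by simp
    with K(2)[OF z A sets.top] show ?thesis by (rule LIMSEQ_unique)
  qed
  have K_snd: "emeasure (K z) (space M1 \<times> B) = emeasure (t2 (snd z)) B" if z: "z \<in> \<Delta>" and B: "B \<in> sets M2" for z B
  proof -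
    have zs: "fst z \<in> space M1" "snd z \<in> space M2" using z by (auto simp: \<Delta>_def)
    interpret cell_coupling "t1 (fst z)" "t2 (snd z)" D1 D2 using coupling[OF z] .
    have "(\<lambda>n. ennreal (?Q z n (space M1) B)) = (\<lambda>n. emeasure (t2 (snd z)) B)"
      using approx_snd[of B] B t1[OF zs(1)] t2[OF zs(2)] by (simp add: N2.emeasure_eq_measure)
    then have "(\<lambda>n. ennreal (?Q z n (space M1) B)) \<longlonglongrightarrow> emeasure (t2 (snd z)) B" by simp
    with K(2)[OF z sets.top B] show ?thesis by (rule LIMSEQ_unique)
  qed
  have K_off: "emeasure (K z) (space M1 \<times> space M2 - \<Delta>) = 0" if z: "z \<in> \<Delta>" for z
  proof -
    have zs: "fst z \<in> space M1" "snd z \<in> space M2" using z by (auto simp: \<Delta>_def)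
    interpret cell_coupling "t1 (fst z)" "t2 (snd z)" D1 D2 using coupling[OF z] .
    \<comment> \<open>The approximations vanish only from stage \<open>i + 1\<close> on, which is
      enough for the limit.\<close>
    have null: "emeasure (K z) (A \<times> B) = 0"
      if "A \<in> sets M1" "B \<in> sets M2" "\<And>n. i < n \<Longrightarrow> ?Q z n A B = 0" for A B i
    proof (rule LIMSEQ_unique[OF K(2)[OF z that(1,2)]])
      have "\<forall>\<^sub>F n in sequentially. ennreal (?Q z n A B) = 0"
        using that(3) by (intro eventually_sequentiallyI[of "Suc i"]) simp
      then show "(\<lambda>n. ennreal (?Q z n A B)) \<longlonglongrightarrow> 0"
        by (simp add: tendsto_eventually)
    qed
    have "emeasure (K z) (D1 i \<times> (space M2 - D2 i)) = 0" for i
      using approx_off_diagonal(1)[of i] D t2(2)[OF zs(2)] by (intro null[of _ _ i]) auto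
    moreover have "emeasure (K z) ((space M1 - D1 i) \<times> D2 i) = 0" for i
      using approx_off_diagonal(2)[of i] D t1(2)[OF zs(1)] by (intro null[of _ _ i]) auto
    ultimately have "D1 i \<times> (space M2 - D2 i) \<union> (space M1 - D1 i) \<times> D2 i \<in> null_sets (K z)" for i
      using D K(1)[OF z] by (intro null_sets.Un) (auto simp: null_sets_def)
    then have "(\<Union>i. D1 i \<times> (space M2 - D2 i) \<union> (space M1 - D1 i) \<times> D2 i) \<in> null_sets (K z)"
      by (intro null_sets_UN)
    then show ?thesis unfolding off by auto
  qed
  have "fst \<in> measurable ?S M1" "snd \<in> measurable ?S M2"
    by (auto intro: measurable_restrict_space1)
  then have t1S: "(\<lambda>z. t1 (fst z)) \<in> measurable ?S (subprob_algebra M1)"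
    and t2S: "(\<lambda>z. t2 (snd z)) \<in> measurable ?S (subprob_algebra M2)"
    using t by (auto intro: measurable_compose)
  have Q_meas: "(\<lambda>z. ennreal (?Q z n A B)) \<in> borel_measurable ?S"
    if AB: "A \<in> sets M1" "B \<in> sets M2" for n A B
  proof -
    have m1: "(\<lambda>z. measure (t1 (fst z)) A') \<in> borel_measurable ?S" if "A' \<in> sets M1" for A'
      by (rule measurable_compose[OF t1S measurable_measure_subprob_algebra[OF that]])
    have m2: "(\<lambda>z. measure (t2 (snd z)) B') \<in> borel_measurable ?S" if "B' \<in> sets M2" for B'
      by (rule measurable_compose[OF t2S measurable_measure_subprob_algebra[OF that]])
    have "(\<lambda>z. \<Sum>J\<in>Pow {..<n}. measure (t1 (fst z)) (A \<inter> cell (space M1) D1 n J) *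
        measure (t2 (snd z)) (B \<inter> cell (space M2) D2 n J) / measure (t1 (fst z)) (cell (space M1) D1 n J))
      \<in> borel_measurable ?S"
      using AB D by (intro borel_measurable_sum borel_measurable_divide borel_measurable_times m1 m2 sets.Int cell_sets)
    also have "?this \<longleftrightarrow> (\<lambda>z. ?Q z n A B) \<in> borel_measurable ?S"
    proof (rule measurable_cong)
      fix z assume "z \<in> space ?S"
      then have "fst z \<in> space M1" "snd z \<in> space M2" unfolding space_S using \<Delta>_sub by auto
      then show "(\<Sum>J\<in>Pow {..<n}. measure (t1 (fst z)) (A \<inter> cell (space M1) D1 n J) *
        measure (t2 (snd z)) (B \<inter> cell (space M2) D2 n J) / measure (t1 (fst z)) (cell (space M1) D1 n J)) = ?Q z n A B"
        by (rule cell_approx_eq[OF t1(1) t2(1), symmetric])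
    qed
    finally show ?thesis by (rule measurable_compose[OF _ measurable_ennreal])
  qed
  \<comment> \<open>Rectangles form a generator stable under intersection, so it suffices that the
    masses of rectangles depend measurably on \<open>z\<close>. They are pointwise limits of the
    functions in \<open>Q_meas\<close>.\<close>
  have K_meas: "K \<in> measurable ?S (subprob_algebra ?P)"
  proof (rule measurable_subprob_algebra_generated[where \<Omega> = "space M1 \<times> space M2" and G = "{a \<times> b |a b. a \<in> sets M1 \<and> b \<in> sets M2}"])
    show "sets ?P = sigma_sets (space M1 \<times> space M2) {a \<times> b |a b. a \<in> sets M1 \<and> b \<in> sets M2}"
      by (rule sets_pair_measure)
    show "Int_stable {a \<times> b |a b. a \<in> sets M1 \<and> b \<in> sets M2}"
      by (rule Int_stable_pair_measure_generator)
    show "{a \<times> b |a b. a \<in> sets M1 \<and> b \<in> sets M2} \<subseteq> Pow (space M1 \<times> space M2)"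
      by (rule pair_measure_closed)
    show sets_K: "sets (K z) = sets ?P" if "z \<in> space ?S" for z
      using K(1) that unfolding space_S .
    show "subprob_space (K z)" if "z \<in> space ?S" for z
    proof (rule subprob_spaceI)
      have z: "z \<in> \<Delta>" "fst z \<in> space M1" using that \<Delta>_sub unfolding space_S by auto
      have sp: "space (K z) = space M1 \<times> space M2"
        using sets_eq_imp_space_eq[OF sets_K[OF that]] by (simp add: space_pair_measure)
      show "emeasure (K z) (space (K z)) \<le> 1"
        unfolding sp K_fst[OF z(1) sets.top] using subprob_space.emeasure_space_le_1[OF t1(3)[OF z(2)]]
        by (simp add: t1(2)[OF z(2)])
      show "space (K z) \<noteq> {}" unfolding sp using z(1) \<Delta>_sub by blast
    qed
    have "(\<lambda>z. emeasure (K z) (A \<times> B)) \<in> borel_measurable ?S" if "A \<in> sets M1" "B \<in> sets M2" for A B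
    proof (rule borel_measurable_LIMSEQ_order)
      show "(\<lambda>n. ennreal (?Q z n A B)) \<longlonglongrightarrow> emeasure (K z) (A \<times> B)" if "z \<in> space ?S" for z
        using K(2) that \<open>A \<in> sets M1\<close> \<open>B \<in> sets M2\<close> unfolding space_S by blast
    qed (rule Q_meas[OF that])
    then show "(\<lambda>z. emeasure (K z) (space M1 \<times> space M2)) \<in> borel_measurable ?S"
      and "\<And>R. R \<in> {a \<times> b |a b. a \<in> sets M1 \<and> b \<in> sets M2} \<Longrightarrow>
        (\<lambda>z. emeasure (K z) R) \<in> borel_measurable ?S"
      by auto
  qed
  \<comment> \<open>\<open>K z\<close> lives on the whole product. For
    \<open>z \<in> \<Delta>\<close> it gives the complement of \<open>\<Delta>\<close> mass 0, so
    restricting it changes no mass and the marginals are kept.\<close>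
  define t where "t z = restrict_space (K z) \<Delta>" for z
  have "t \<in> measurable ?S (subprob_algebra ?S)"
  proof (cases "\<Delta> = {}")
    case True
    then have "space ?S = {}" by (simp add: space_S)
    then show ?thesis by (intro measurableI) auto
  next
    case False
    then show ?thesis
      unfolding t_def using \<Delta> K_meas by (rule restrict_space_measurable)
  qed
  moreover have t_eq: "emeasure (t z) (R \<inter> \<Delta>) = emeasure (K z) R" if z: "z \<in> \<Delta>" and R: "R \<in> sets ?P" for z R
  proof -
    have \<Delta>_K: "\<Delta> \<in> sets (K z)" "R \<in> sets (K z)" "space (K z) = space M1 \<times> space M2"
      using \<Delta> R K(1)[OF z] sets_eq_imp_space_eq[OF K(1)[OF z]] by (simp_all add: space_pair_measure)
    then have "space M1 \<times> space M2 - \<Delta> \<in> null_sets (K z)"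
      using K_off[OF z] by (metis null_setsI sets.compl_sets)
    then have "emeasure (K z) (R - (space M1 \<times> space M2 - \<Delta>)) = emeasure (K z) R"
      using \<Delta>_K(2) by (rule emeasure_Diff_null_set)
    moreover have "R - (space M1 \<times> space M2 - \<Delta>) = R \<inter> \<Delta>"
      using sets.sets_into_space[OF \<Delta>_K(2)] \<Delta>_K(3) by auto
    moreover have "emeasure (t z) (R \<inter> \<Delta>) = emeasure (K z) (R \<inter> \<Delta>)"
      unfolding t_def using \<Delta>_K(1) by (intro emeasure_restrict_space sets.Int sets.top) auto
    ultimately show ?thesis by simp
  qed
  moreover have "emeasure (t z) (fst -` A \<inter> \<Delta>) = emeasure (t1 (fst z)) A" if z: "z \<in> \<Delta>" and A: "A \<in> sets M1" for z A
  proof -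
    have "fst -` A \<inter> \<Delta> = (A \<times> space M2) \<inter> \<Delta>" using \<Delta>_sub by auto
    then show ?thesis using t_eq[OF z, of "A \<times> space M2"] A K_fst[OF z A] by simp
  qed
  moreover have "emeasure (t z) (snd -` B \<inter> \<Delta>) = emeasure (t2 (snd z)) B" if z: "z \<in> \<Delta>" and B: "B \<in> sets M2" for z B
  proof -
    have "snd -` B \<inter> \<Delta> = (space M1 \<times> B) \<inter> \<Delta>" using \<Delta>_sub by auto
    then show ?thesis using t_eq[OF z, of "space M1 \<times> B"] B K_snd[OF z B] by simp
  qed
  ultimately show ?thesis by blast
qed

section \<open>The semipullback of a cospan\<close>

theorem corollary5p4:
  fixes L :: "'l set"
    and S0 :: "'c measure" and \<tau>0 :: "'l \<Rightarrow> 'c \<Rightarrow> 'c measure"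
    and S1 :: "'a measure" and \<tau>1 :: "'l \<Rightarrow> 'a \<Rightarrow> 'a measure"
    and S2 :: "'b measure" and \<tau>2 :: "'l \<Rightarrow> 'b \<Rightarrow> 'b measure"
    and h1 :: "'a \<Rightarrow> 'c" and h2 :: "'b \<Rightarrow> 'c"
  assumes "coanalytic_LMP L S0 \<tau>0"
    and "coanalytic_LMP L S1 \<tau>1"
    and "coanalytic_LMP L S2 \<tau>2"
    and "zigzag L S1 \<tau>1 S0 \<tau>0 h1"
    and "zigzag L S2 \<tau>2 S0 \<tau>0 h2"
  shows "\<exists>(S3 :: ('a \<times> 'b) measure) (\<tau>3 :: 'l \<Rightarrow> 'a \<times> 'b \<Rightarrow> ('a \<times> 'b) measure) k1 k2.
           coanalytic_LMP L S3 \<tau>3 \<and>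
           zigzag L S3 \<tau>3 S1 \<tau>1 k1 \<and>
           zigzag L S3 \<tau>3 S2 \<tau>2 k2 \<and>
           (\<forall>x\<in>space S3. h1 (k1 x) = h2 (k2 x))"
proof -
  obtain X0 :: "real topology" and e0 where e0: "coanalytic_embedding S0 X0 e0"
    using assms(1) coanalytic_measurable_space_imp_embedding unfolding coanalytic_LMP_def by blast
  obtain X1 :: "real topology" and e1 where e1: "coanalytic_embedding S1 X1 e1"
    using assms(2) coanalytic_measurable_space_imp_embedding unfolding coanalytic_LMP_def by blast
  obtain X2 :: "real topology" and e2 where e2: "coanalytic_embedding S2 X2 e2"
    using assms(3) coanalytic_measurable_space_imp_embedding unfolding coanalytic_LMP_def by blast
  obtain C :: "nat \<Rightarrow> 'c set" where C: "\<And>i. C i \<in> sets S0"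
    "\<forall>x\<in>space S0. \<forall>y\<in>space S0. (\<forall>i. x \<in> C i \<longleftrightarrow> y \<in> C i) \<longrightarrow> x = y"
    using coanalytic_embedding_countable_separating[OF e0] by blast
  have h: "h1 \<in> measurable S1 S0" "h2 \<in> measurable S2 S0"
    "h1 ` space S1 = space S0" "h2 ` space S2 = space S0"
    using assms(4,5) by (simp_all add: zigzag_def)
  define \<Delta> where "\<Delta> = {z \<in> space S1 \<times> space S2. h1 (fst z) = h2 (snd z)}"
  define S3 where "S3 = restrict_space (S1 \<Otimes>\<^sub>M S2) \<Delta>"
  have \<Delta>: "\<Delta> \<in> sets (S1 \<Otimes>\<^sub>M S2)"
    unfolding \<Delta>_def by (rule fibre_product_sets(4)[OF h(1,2) C])
  have space_S3: "space S3 = \<Delta>" unfolding S3_def using \<Delta> by (rule space_restrict_space2)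
  have "coanalytic_embedding S3 (prod_topology X1 X2) (map_prod e1 e2)"
    unfolding S3_def
    by (rule coanalytic_embedding_restrict_space[OF coanalytic_embedding_pair_measure[OF e1 e2] \<Delta>])
  then have S3: "coanalytic_measurable_space S3" by (rule coanalytic_embedding_imp_measurable_space)
  have "\<forall>a\<in>L. \<exists>t. t \<in> measurable S3 (subprob_algebra S3) \<and>
    (\<forall>z\<in>\<Delta>. (\<forall>A\<in>sets S1. emeasure (t z) (fst -` A \<inter> \<Delta>) = emeasure (\<tau>1 a (fst z)) A) \<and>
       (\<forall>B\<in>sets S2. emeasure (t z) (snd -` B \<inter> \<Delta>) = emeasure (\<tau>2 a (snd z)) B))"
  proof
    fix a assume a: "a \<in> L"
    show "\<exists>t. t \<in> measurable S3 (subprob_algebra S3) \<and>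
      (\<forall>z\<in>\<Delta>. (\<forall>A\<in>sets S1. emeasure (t z) (fst -` A \<inter> \<Delta>) = emeasure (\<tau>1 a (fst z)) A) \<and>
         (\<forall>B\<in>sets S2. emeasure (t z) (snd -` B \<inter> \<Delta>) = emeasure (\<tau>2 a (snd z)) B))"
      unfolding S3_def \<Delta>_def
    proof (rule fibre_product_kernel[OF e1 e2 h(1,2) C])
      show "\<tau>1 a \<in> measurable S1 (subprob_algebra S1)" "\<tau>2 a \<in> measurable S2 (subprob_algebra S2)"
        using assms(2,3) a by (simp_all add: coanalytic_LMP_def LMP_def)
      \<comment> \<open>By the zigzag property both sides are the mass of \<open>Q\<close> under the
        kernel of the base at the common image point.\<close>
      show "emeasure (\<tau>1 a x) (h1 -` Q \<inter> space S1) = emeasure (\<tau>2 a y) (h2 -` Q \<inter> space S2)"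
        if "x \<in> space S1" "y \<in> space S2" "h1 x = h2 y" "Q \<in> sets S0" for x y Q
        using assms(4,5) a that by (simp add: zigzag_def)
    qed
  qed
  from bchoice[OF this] obtain \<tau>3 where
    \<tau>3: "\<And>a. a \<in> L \<Longrightarrow> \<tau>3 a \<in> measurable S3 (subprob_algebra S3)"
      "\<And>a z A. a \<in> L \<Longrightarrow> z \<in> \<Delta> \<Longrightarrow> A \<in> sets S1 \<Longrightarrow> emeasure (\<tau>3 a z) (fst -` A \<inter> \<Delta>) = emeasure (\<tau>1 a (fst z)) A"
      "\<And>a z B. a \<in> L \<Longrightarrow> z \<in> \<Delta> \<Longrightarrow> B \<in> sets S2 \<Longrightarrow> emeasure (\<tau>3 a z) (snd -` B \<inter> \<Delta>) = emeasure (\<tau>2 a (snd z)) B"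
    by blast
  have "coanalytic_LMP L S3 \<tau>3"
    using S3 \<tau>3(1) by (simp add: coanalytic_LMP_def LMP_def)
  moreover have "zigzag L S3 \<tau>3 S1 \<tau>1 fst"
    unfolding zigzag_def space_S3
  proof (intro conjI ballI)
    show "fst \<in> measurable S3 S1" unfolding S3_def by (rule measurable_restrict_space1) simp
    show "fst ` \<Delta> = space S1"
    proof
      show "space S1 \<subseteq> fst ` \<Delta>"
      proof
        fix x assume x: "x \<in> space S1"
        \<comment> \<open>Surjectivity of \<open>h2\<close> provides a partner for \<open>x\<close>
          in the fibre product.\<close>
        then have "h1 x \<in> h2 ` space S2" using h(3,4) by blast
        then obtain y where "y \<in> space S2" "h1 x = h2 y" by blast
        then show "x \<in> fst ` \<Delta>" using x by (intro image_eqI[of _ _ "(x, y)"]) (auto simp: \<Delta>_def)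
      qed
    qed (auto simp: \<Delta>_def)
  qed (use \<tau>3(2) in blast)
  moreover have "zigzag L S3 \<tau>3 S2 \<tau>2 snd"
    unfolding zigzag_def space_S3
  proof (intro conjI ballI)
    show "snd \<in> measurable S3 S2" unfolding S3_def by (rule measurable_restrict_space1) simp
    show "snd ` \<Delta> = space S2"
    proof
      show "space S2 \<subseteq> snd ` \<Delta>"
      proof
        fix y assume y: "y \<in> space S2"
        then have "h2 y \<in> h1 ` space S1" using h(3,4) by blast
        then obtain x where "x \<in> space S1" "h2 y = h1 x" by blast
        then show "y \<in> snd ` \<Delta>" using y by (intro image_eqI[of _ _ "(x, y)"]) (auto simp: \<Delta>_def)
      qed
    qed (auto simp: \<Delta>_def)
  qed (use \<tau>3(3) in blast)
  moreover have "\<forall>x\<in>space S3. h1 (fst x) = h2 (snd x)"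
    unfolding space_S3 by (auto simp: \<Delta>_def)
  ultimately show ?thesis by blast
qed

end
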